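(* Let $d \geq 3$ be a real number and put $j_d := j\!\left(\frac{1+\sqrt{-d}}{2}\right)$, $\beta_d := \sqrt{1728 j_d^2 - j_d^3}$, \[ t_d := -\frac{1}{768}\left(\left(-884736 j_d + 2304 j_d^2 - j_d^3 - 12288\sqrt{3}\,\beta_d\right)^{\frac13} + \left(-884736 j_d + 2304 j_d^2 - j_d^3 + 12288\sqrt{3}\,\beta_d\right)^{\frac13}\right), \] \[ a_d := \frac{1}{48}\left(\sqrt{1728 - j_d} + \left(\beta_d - 24\sqrt{3} j_d\right)^{\frac13} + \left(\beta_d + 24\sqrt{3} j_d\right)^{\frac13}\right), \] \[ b_d := \frac{1}{48}\sqrt{\left(\sqrt{3}\left(\left(\beta_d - 24\sqrt{3} j_d\right)^{\frac13} - \left(\beta_d + 24\sqrt{3} j_d\right)^{\frac13}\right) + 24\right)^2 + 1152 - 9 j_d}, \] \[ c_d := \frac{1}{48}\sqrt{-2304\, t_d + 1728 - 3 j_d}. \] Then $a_d, b_d, c_d$ are real numbers, and with $i=\sqrt{-1}$ and $\sqrt{-d} = i\sqrt{d}$: \[ \lambda\!\left(\tfrac{1+\sqrt{-d}}{2}\right) = \frac{1}{\frac12 - i a_d} = \frac{1}{\frac12 - i b_d} = \frac{1}{\frac12 - i c_d},\qquad \lambda\!\left(\tfrac{\sqrt{-d}-1}{\sqrt{-d}+1}\right) = \tfrac12 + i a_d = \tfrac12 + i b_d = \tfrac12 + i c_d, \] \[ \lambda\!\left(\tfrac{2}{1-\sqrt{-d}}\right) = \frac{i a_d - \frac12}{i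 a_d + \frac12} = \frac{i b_d - \frac12}{i b_d + \frac12} = \frac{i c_d - \frac12}{i c_d + \frac12},\qquad \lambda\!\left(-\tfrac{2}{1+\sqrt{-d}}\right) = \frac{i a_d + \frac12}{i a_d - \frac12} = \frac{i b_d + \frac12}{i b_d - \frac12} = \frac{i c_d + \frac12}{i c_d - \frac12}, \] \[ \lambda\!\left(-\tfrac{\sqrt{-d}+1}{\sqrt{-d}-1}\right) = \tfrac12 - i a_d = \tfrac12 - i b_d = \tfrac12 - i c_d,\qquad \lambda\!\left(\tfrac{-1+\sqrt{-d}}{2}\right) = \frac{1}{\frac12 + i a_d} = \frac{1}{\frac12 + i b_d} = \frac{1}{\frac12 + i c_d}. \]
   Context: For $\tau$ in the upper half plane let $q := e^{2\pi i \tau}$ and $q^{s} := e^{2\pi i s\tau}$ for rational $s$. The elliptic lambda function is $\lambda(\tau) := 16 q^{1/2} \prod_{n=1}^{\infty} \frac{(1+q^n)^8}{(1+q^{n-1/2})^8}$ and the elliptic modular function is $j(\tau) := 2^8 \frac{(1-\lambda(\tau)+\lambda(\tau)^2)^3}{\lambda(\tau)^2(1-\lambda(\tau))^2}$. For $d\ge 3$ one has $j_d \le 0$, so all radicands above are real; $x^{1/3}$ denotes the real cube root of a real number $x$, and square roots of nonnegative reals are the nonnegative ones. *)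

theory Defs
  imports "HOL-Analysis.Analysis"
begin

definition qpow :: "complex \<Rightarrow> real \<Rightarrow> complex" where
  "qpow \<tau> s = exp (2 * of_real pi * \<i> * of_real s * \<tau>)"

text \<open>
  The functions \<open>\<lambda>\<close> and \<open>j\<close> are meant only for arguments in the upper half plane, where the
  infinite product converges. The product runs over \<open>n \<ge> 1\<close>, hence the shift by \<open>Suc\<close>.
\<close>
definition elliptic_lambda :: "complex \<Rightarrow> complex" where
  "elliptic_lambda \<tau> = 16 * qpow \<tau> (1/2) *
     (\<Prod>n. (1 + qpow \<tau> (real (Suc n))) ^ 8 / (1 + qpow \<tau> (real (Suc n) - 1/2)) ^ 8)"

definition elliptic_j :: "complex \<Rightarrow> complex" where
  "elliptic_j \<tau> =
     2 ^ 8 * (1 - elliptic_lambda \<tau> + elliptic_lambda \<tau> ^ 2) ^ 3 /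
       (elliptic_lambda \<tau> ^ 2 * (1 - elliptic_lambda \<tau>) ^ 2)"

text \<open>\<open>\<i> \<surd>d\<close>, the chosen value of \<open>\<surd>(-d)\<close>.\<close>
definition sqrt_neg :: "real \<Rightarrow> complex" where
  "sqrt_neg d = \<i> * of_real (sqrt d)"

text \<open>
  The radicals are the real functions \<^const>\<open>sqrt\<close> and \<^term>\<open>root 3\<close>; the latter is the real
  cube root on all of the reals. Hence \<open>j\<^sub>d\<close> is taken as a real number by means of \<^const>\<open>Re\<close>,
  which loses nothing only when \<open>j((1 + \<surd>(-d))/2)\<close> is real; and \<^const>\<open>sqrt\<close> is total
  (\<^prop>\<open>sqrt (- x) = - sqrt x\<close>), so it is the square root only of a nonnegative radicand.
  That the values below are the intended real numbers is thus a separate proposition,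
  \<open>radicals_real\<close>.
\<close>
definition j_d :: "real \<Rightarrow> real" where
  "j_d d = Re (elliptic_j ((1 + sqrt_neg d) / 2))"

definition beta_rad :: "real \<Rightarrow> real" where
  "beta_rad d = 1728 * j_d d ^ 2 - j_d d ^ 3"

definition beta_d :: "real \<Rightarrow> real" where
  "beta_d d = sqrt (beta_rad d)"

definition t_d :: "real \<Rightarrow> real" where
  "t_d d = - (1/768) *
     (root 3 (- 884736 * j_d d + 2304 * j_d d ^ 2 - j_d d ^ 3 - 12288 * sqrt 3 * beta_d d) +
      root 3 (- 884736 * j_d d + 2304 * j_d d ^ 2 - j_d d ^ 3 + 12288 * sqrt 3 * beta_d d))"

definition a_rad :: "real \<Rightarrow> real" where
  "a_rad d = 1728 - j_d d"

definition a_d :: "real \<Rightarrow> real" where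
  "a_d d = (1/48) *
     (sqrt (a_rad d) + root 3 (beta_d d - 24 * sqrt 3 * j_d d)
                     + root 3 (beta_d d + 24 * sqrt 3 * j_d d))"

definition b_rad :: "real \<Rightarrow> real" where
  "b_rad d =
     (sqrt 3 * (root 3 (beta_d d - 24 * sqrt 3 * j_d d) -
                root 3 (beta_d d + 24 * sqrt 3 * j_d d)) + 24) ^ 2 + 1152 - 9 * j_d d"

definition b_d :: "real \<Rightarrow> real" where
  "b_d d = (1/48) * sqrt (b_rad d)"

definition c_rad :: "real \<Rightarrow> real" where
  "c_rad d = - 2304 * t_d d + 1728 - 3 * j_d d"

definition c_d :: "real \<Rightarrow> real" where
  "c_d d = (1/48) * sqrt (c_rad d)"

definition radicals_real :: "real \<Rightarrow> bool" where
  "radicals_real d \<longleftrightarrow>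
     elliptic_j ((1 + sqrt_neg d) / 2) \<in> \<real> \<and> j_d d \<le> 0 \<and>
     beta_rad d \<ge> 0 \<and> a_rad d \<ge> 0 \<and> b_rad d \<ge> 0 \<and> c_rad d \<ge> 0"

end

theory Submission
  imports Defs "HOL-Complex_Analysis.Complex_Analysis"
begin

text \<open>
  Let \<open>\<theta>(z) = \<Prod>n. (1 + x^(2n+1) e(z)) (1 + x^(2n+1) e(-z))\<close>, where \<open>x = exp (\<pi> i \<tau>)\<close> and
  \<open>e(z) = exp (2 \<pi> i z)\<close>. Then \<open>\<lambda>(\<tau>) = x (\<theta>(\<tau>/2) / \<theta>(0))^4\<close>. By Liouville's theorem, an even
  entire function with the quasi-periodicity of \<open>\<theta>\<close> (of \<open>\<theta>^2\<close>, if it vanishes at \<open>(1+\<tau>)/2\<close>)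
  is a multiple of \<open>\<theta>\<close> (of \<open>\<theta>^2\<close>). This gives Jacobi's quartic identity, hence
  \<open>\<lambda>(\<tau>+1) = \<lambda>(\<tau>)/(\<lambda>(\<tau>)-1)\<close>, and \<open>\<lambda>(-1/\<tau>) = 1 - \<lambda>(\<tau>)\<close>, so all six values follow from
  \<open>\<lambda>((1+\<surd>(-d))/2)\<close>.

  At \<open>\<tau> = (1+\<surd>(-d))/2\<close> the nome is \<open>x = i r\<close> with \<open>r = exp (- \<pi> \<surd>d / 2)\<close>, so that \<open>1 - \<lambda>(\<tau>)\<close>
  has modulus 1 and \<open>1/\<lambda>(\<tau>) = 1/2 - i v/2\<close> with \<open>v\<close> real. The argument of \<open>1 - \<lambda>(\<tau>)\<close> is
  monotone in \<open>r\<close> and known at \<open>d = 3\<close>, because \<open>(1+\<surd>(-3))/2\<close> is an elliptic fixed point; this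
  gives \<open>v \<ge> \<surd>3\<close>. As \<open>j\<^sub>d = - 64 (v^2-3)^3/(v^2+1)^2\<close>, the radicands are explicit squares and
  cubes of functions of \<open>v\<close> and \<open>\<surd>3\<close>.
\<close>

section \<open>Entire functions with prescribed zeros and periods\<close>

text \<open>Simple zeros of \<open>g\<close> are removable singularities of \<open>f / g\<close>.
  Near such a zero \<open>p\<close> the quotient is rewritten with the difference quotients
  \<open>F\<close> and \<open>G\<close> at \<open>p\<close>, which are entire, and
  \<open>G p = deriv g p\<close> does not vanish.\<close>

lemma entire_quotient:
  fixes f g :: "complex \<Rightarrow> complex"
  assumes f: "f holomorphic_on UNIV" and g: "g holomorphic_on UNIV"
    and zeros: "\<And>z. g z = 0 \<Longrightarrow> f z = 0 \<and> deriv g z \<noteq> 0"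
  obtains h where "h holomorphic_on UNIV" "\<And>z. f z = h z * g z"
proof -
  define h where "h z = (if g z = 0 then deriv f z / deriv g z else f z / g z)" for z
  have "h field_differentiable at p" for p
  proof (cases "g p = 0")
    case False
    have op: "open {z. g z \<noteq> 0}"
      using g holomorphic_on_imp_continuous_on open_Collect_neq continuous_on_const by blast
    have "(\<lambda>z. f z / g z) holomorphic_on {z. g z \<noteq> 0}"
      by (intro holomorphic_intros holomorphic_on_subset[OF f] holomorphic_on_subset[OF g]) auto
    hence "h holomorphic_on {z. g z \<noteq> 0}"
      by (rule holomorphic_transform) (auto simp: h_def)
    thus ?thesis
      using op False by (auto simp: holomorphic_on_open field_differentiable_def)
  next
    case True
    define F where "F z = (if z = p then deriv f p else (f z - f p) / (z - p))" for z
    define G where "G z = (if z = p then deriv g p else (g z - g p) / (z - p))" for z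
    have F: "F holomorphic_on UNIV" and G: "G holomorphic_on UNIV"
      unfolding F_def G_def using pole_lemma_open[OF f] pole_lemma_open[OF g] by auto
    have op: "open {z. G z \<noteq> 0}"
      using G holomorphic_on_imp_continuous_on open_Collect_neq continuous_on_const by blast
    have "(\<lambda>z. F z / G z) holomorphic_on {z. G z \<noteq> 0}"
      by (intro holomorphic_intros holomorphic_on_subset[OF F] holomorphic_on_subset[OF G]) auto
    \<comment> \<open>Both \<open>f\<close> and \<open>g\<close> vanish at \<open>p\<close>, so away
      from \<open>p\<close> the factor \<open>z - p\<close> cancels in \<open>F z / G z\<close>; at
      \<open>p\<close> the two sides agree by the choice of the value of \<open>h\<close>.\<close>
    hence "h holomorphic_on {z. G z \<noteq> 0}"
      by (rule holomorphic_transform)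
         (use True zeros[OF True] in \<open>auto simp: h_def F_def G_def split: if_splits\<close>)
    moreover have "G p \<noteq> 0"
      using zeros[OF True] by (simp add: G_def)
    ultimately show ?thesis
      using op by (auto simp: holomorphic_on_open field_differentiable_def)
  qed
  hence "h holomorphic_on UNIV"
    by (simp add: holomorphic_on_def field_differentiable_at_within)
  moreover have "f z = h z * g z" for z
    using zeros[of z] by (auto simp: h_def)
  ultimately show ?thesis using that by blast
qed

text \<open>If \<open>k\<close> and \<open>l\<close> differed at \<open>z\<close>, they would differ
  on a neighbourhood, so \<open>g\<close> would vanish there together with its derivative. This
  carries functional equations over to quotients by theta, including at the zeros of theta.\<close>

lemma mult_right_cancel_simple_zeros:
  fixes k l g :: "complex \<Rightarrow> complex"
  assumes k: "k holomorphic_on UNIV" and l: "l holomorphic_on UNIV"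
    and zeros: "\<And>z. g z = 0 \<Longrightarrow> deriv g z \<noteq> 0"
    and eq: "\<And>z. k z * g z = l z * g z"
  shows "k z = l z"
proof (rule ccontr)
  assume "k z \<noteq> l z"
  have "open {w. k w \<noteq> l w}"
    using k l holomorphic_on_imp_continuous_on open_Collect_neq by blast
  hence "eventually (\<lambda>w. w \<in> {w. k w \<noteq> l w}) (nhds z)"
    using \<open>k z \<noteq> l z\<close> by (intro eventually_nhds_in_open) auto
  hence ev: "eventually (\<lambda>w. g w = 0) (nhds z)"
    by eventually_elim (use eq in auto)
  hence "deriv g z = deriv (\<lambda>_. 0) z"
    by (rule deriv_cong_ev) simp
  thus False
    using zeros[of z] eventually_nhds_x_imp_x[OF ev] by simp
qed

text \<open>With an arbitrary predicate, one induction covers equality of values, vanishing and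
  simplicity of a zero along the lattice.\<close>

lemma add_int_multiple_iff:
  fixes Q :: "complex \<Rightarrow> bool"
  assumes "\<And>z. Q (z + w) \<longleftrightarrow> Q z"
  shows "Q (z + of_int n * w) \<longleftrightarrow> Q z"
proof (induction n rule: int_induct[of _ 0])
  case (step1 i)
  thus ?case using assms[of "z + of_int i * w"] by (simp add: algebra_simps)
next
  case (step2 i)
  thus ?case using assms[of "z + of_int (i - 1) * w"] by (simp add: algebra_simps)
qed simp

text \<open>All values are attained on the compact period parallelogram \<open>K\<close>, so
  Liouville's theorem applies.\<close>

lemma doubly_periodic_entire_constant:
  assumes h: "h holomorphic_on UNIV" and \<tau>: "Im \<tau> > 0"
    and per1: "\<And>z. h (z + 1) = h z" and per2: "\<And>z. h (z + \<tau>) = h z"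
  shows "\<exists>c. \<forall>z. h z = c"
proof -
  define K where "K = (\<lambda>(s, t). of_real s + of_real t * \<tau>) ` ({0..1::real} \<times> {0..1::real})"
  have "compact K"
    unfolding K_def
    by (intro compact_continuous_image compact_Times compact_Icc)
       (auto intro!: continuous_intros simp: case_prod_unfold)
  hence "bounded (h ` K)"
    by (intro compact_imp_bounded compact_continuous_image
          holomorphic_on_imp_continuous_on[OF holomorphic_on_subset[OF h]]) auto
  moreover have "h z \<in> h ` K" for z
  proof -
    define t where "t = Im z / Im \<tau>"
    define s where "s = Re z - t * Re \<tau>"
    have z: "z = of_real s + of_real t * \<tau>"
      using \<tau> by (simp add: complex_eq_iff s_def t_def)
    define w where "w = of_real (frac s) + of_real (frac t) * \<tau>"
    have "w \<in> K"
      unfolding K_def w_def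
      by (rule image_eqI[of _ _ "(frac s, frac t)"]) (auto simp: frac_lt_1 less_imp_le)
    moreover have "z = w + of_int \<lfloor>s\<rfloor> * 1 + of_int \<lfloor>t\<rfloor> * \<tau>"
      unfolding z w_def frac_def by (simp add: algebra_simps)
    hence "h z = h w"
      using add_int_multiple_iff[of "\<lambda>z. h z = h w" \<tau> "w + of_int \<lfloor>s\<rfloor> * 1" "\<lfloor>t\<rfloor>"]
            add_int_multiple_iff[of "\<lambda>z. h z = h w" 1 w "\<lfloor>s\<rfloor>"] per1 per2 by simp
    ultimately show ?thesis by blast
  qed
  ultimately have "bounded (range h)"
    by (meson bounded_subset image_subsetI)
  hence "h constant_on UNIV"
    using Liouville_theorem[OF h] by blast
  thus ?thesis
    by (auto simp: constant_on_def)
qed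

section \<open>The theta product\<close>

text \<open>This is the q-Pochhammer symbol (-u; q)_infinity; with this sign the factors have the
  shape found in the product for lambda.\<close>

definition qprod :: "complex \<Rightarrow> complex \<Rightarrow> complex" where
  "qprod q u = (\<Prod>n. 1 + q ^ n * u)"

lemma convergent_prod_qprod:
  fixes q u :: complex
  assumes "norm q < 1"
  shows "convergent_prod (\<lambda>n. 1 + q ^ n * u)"
proof (rule abs_convergent_prod_imp_convergent_prod)
  have "summable (\<lambda>n. norm q ^ n * norm u)"
    using assms by (intro summable_mult2 summable_geometric) auto
  thus "abs_convergent_prod (\<lambda>n. 1 + q ^ n * u)"
    by (simp add: abs_convergent_prod_conv_summable norm_mult norm_power)
qed

lemma has_prod_qprod:
  assumes "norm q < 1"
  shows "(\<lambda>n. 1 + q ^ n * u) has_prod qprod q u"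
  unfolding qprod_def by (rule convergent_prod_has_prod[OF convergent_prod_qprod[OF assms]])

lemma qprod_eq_0_iff:
  assumes "norm q < 1"
  shows "qprod q u = 0 \<longleftrightarrow> (\<exists>n. 1 + q ^ n * u = 0)"
proof -
  have "qprod q u = 0 \<longleftrightarrow> 0 \<in> range (\<lambda>n. 1 + q ^ n * u)"
    by (rule has_prod_eq_0_iff[OF has_prod_qprod[OF assms]])
  also have "\<dots> \<longleftrightarrow> (\<exists>n. 0 = 1 + q ^ n * u)"
    by (simp only: image_iff bex_UNIV)
  finally show ?thesis
    by (simp only: eq_commute[of 0])
qed

text \<open>The factor for n = 0 is split off. This is the source of the quasi-periodicity of theta,
  and it isolates the vanishing factor at a zero.\<close>

lemma qprod_rec:
  assumes "norm q < 1"
  shows "qprod q u = (1 + u) * qprod q (q * u)"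
proof -
  have "(\<lambda>n. 1 + q ^ Suc n * u) has_prod qprod q (q * u)"
    using has_prod_qprod[OF assms, of "q * u"] by (simp add: mult_ac)
  from has_prod_unique2[OF has_prod_qprod[OF assms, of u] has_prod_Suc_imp[OF this]]
  show ?thesis by (simp add: mult.commute)
qed

lemma qprod_neg_base_nonzero:
  assumes "norm q < 1"
  shows "qprod q (-q) \<noteq> 0"
proof
  assume "qprod q (-q) = 0"
  then obtain n where "1 + q ^ n * - q = 0"
    using qprod_eq_0_iff[OF assms] by blast
  hence "q ^ Suc n = 1"
    by (simp add: mult.commute)
  hence "norm q ^ Suc n = 1"
    by (metis norm_one norm_power)
  moreover have "norm q ^ Suc n < 1"
    using power_strict_mono[of "norm q" 1 "Suc n"] assms by simp
  ultimately show False by simp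
qed

text \<open>The partial products converge uniformly on closed unit balls by the Weierstrass M-test,
  with \<open>R\<close> bounding the argument.\<close>

lemma holomorphic_qprod:
  assumes "norm q < 1"
  shows "qprod q holomorphic_on UNIV"
proof (rule holomorphic_uniform_sequence)
  fix x :: complex
  define R where "R = norm x + 1"
  have "uniformly_convergent_on (cball x 1) (\<lambda>N u. \<Sum>n<N. norm (q ^ n * u))"
  proof (rule Weierstrass_m_test')
    show "norm (norm (q ^ n * u)) \<le> norm q ^ n * R" if "u \<in> cball x 1" for n u
    proof -
      have "norm u \<le> norm x + norm (u - x)"
        using norm_triangle_ineq[of x "u - x"] by simp
      also have "\<dots> \<le> R" using that by (simp add: R_def dist_norm norm_minus_commute)
      finally show ?thesis
        by (simp add: norm_mult norm_power mult_left_mono)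
    qed
    show "summable (\<lambda>n. norm q ^ n * R)"
      using assms by (intro summable_mult2 summable_geometric) auto
  qed
  hence "uniformly_convergent_on (cball x 1) (\<lambda>N u. \<Prod>n<N. 1 + q ^ n * u)"
    by (intro uniformly_convergent_on_prod) (auto intro!: continuous_intros)
  then obtain l where l: "uniform_limit (cball x 1) (\<lambda>N u. \<Prod>n<N. 1 + q ^ n * u) l sequentially"
    by (auto simp: uniformly_convergent_on_def)
  have "l u = qprod q u" if "u \<in> cball x 1" for u
  proof (rule LIMSEQ_unique)
    show "(\<lambda>N. \<Prod>n<N. 1 + q ^ n * u) \<longlonglongrightarrow> l u"
      using tendsto_uniform_limitI[OF l that] .
    show "(\<lambda>N. \<Prod>n<N. 1 + q ^ n * u) \<longlonglongrightarrow> qprod q u"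
      using has_prod_imp_tendsto'[OF has_prod_qprod[OF assms]] .
  qed
  hence "uniform_limit (cball x 1) (\<lambda>N u. \<Prod>n<N. 1 + q ^ n * u) (qprod q) sequentially"
    using l by (subst uniform_limit_cong'[of _ _ _ _ l]) auto
  thus "\<exists>d>0. cball x d \<subseteq> UNIV \<and>
          uniform_limit (cball x d) (\<lambda>N u. \<Prod>n<N. 1 + q ^ n * u) (qprod q) sequentially"
    by (intro exI[of _ 1]) auto
qed (auto intro!: holomorphic_intros)

section \<open>The theta function: periods and zeros\<close>

text \<open>\<open>cexp \<tau>\<close> is the nome, the square root q^(1/2) of
  \<open>cexp (2 * \<tau>)\<close>, which is q in the definition of lambda.\<close>

definition cexp :: "complex \<Rightarrow> complex" where
  "cexp t = exp (of_real pi * \<i> * t)"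

lemma cexp_add: "cexp (a + b) = cexp a * cexp b"
  by (simp add: cexp_def algebra_simps exp_add)

lemma cexp_nonzero [simp]: "cexp a \<noteq> 0"
  by (simp add: cexp_def)

lemma cexp_0 [simp]: "cexp 0 = 1"
  by (simp add: cexp_def)

lemma cexp_1 [simp]: "cexp 1 = -1"
  by (simp add: cexp_def)

lemma cexp_minus_1 [simp]: "cexp (-1) = -1"
  using cexp_add[of 1 "-1"] by (simp add: minus_equation_iff)

lemma cexp_2 [simp]: "cexp 2 = 1"
  using cexp_add[of 1 1] by simp

lemma cexp_minus_2 [simp]: "cexp (-2) = 1"
  using cexp_add[of 2 "-2"] by simp

lemma cexp_power: "cexp a ^ n = cexp (of_nat n * a)"
  by (simp add: cexp_def mult_ac flip: exp_of_nat_mult)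

lemma cexp_eq_iff: "cexp a = cexp b \<longleftrightarrow> (\<exists>n::int. a = b + 2 * of_int n)"
proof -
  have "of_real pi * \<i> * a = of_real pi * \<i> * b + of_int (2 * n) * of_real pi * \<i> \<longleftrightarrow>
        a = b + 2 * of_int n" for n :: int
  proof -
    have "of_real pi * \<i> * a = of_real pi * \<i> * b + of_int (2 * n) * of_real pi * \<i> \<longleftrightarrow>
          of_real pi * \<i> * a = of_real pi * \<i> * (b + 2 * of_int n)"
      by (simp add: algebra_simps)
    also have "\<dots> \<longleftrightarrow> a = b + 2 * of_int n"
      by (subst mult_left_cancel) auto
    finally show ?thesis .
  qed
  thus ?thesis
    unfolding cexp_def by (subst exp_eq) simp
qed

lemma norm_cexp: "norm (cexp a) = exp (- pi * Im a)"
  by (simp add: cexp_def)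

lemma norm_cexp_less_1: "Im a > 0 \<Longrightarrow> norm (cexp a) < 1"
  by (simp add: norm_cexp)

lemma holomorphic_cexp [holomorphic_intros]:
  "f holomorphic_on A \<Longrightarrow> (\<lambda>z. cexp (f z)) holomorphic_on A"
  unfolding cexp_def by (intro holomorphic_intros)

text \<open>
  The Jacobi triple product without its constant factor \<open>\<Prod>n. (1 - q^n)\<close>, which cancels in all
  quotients of theta values considered here.
\<close>
definition theta :: "complex \<Rightarrow> complex \<Rightarrow> complex" where
  "theta \<tau> z = qprod (cexp (2 * \<tau>)) (cexp (\<tau> + 2 * z)) * qprod (cexp (2 * \<tau>)) (cexp (\<tau> - 2 * z))"

lemma theta_minus: "theta \<tau> (-z) = theta \<tau> z"
  by (simp add: theta_def)

lemma theta_plus_1: "theta \<tau> (z + 1) = theta \<tau> z"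
proof -
  have "cexp (\<tau> + 2 * (z + 1)) = cexp (\<tau> + 2 * z)" "cexp (\<tau> - 2 * (z + 1)) = cexp (\<tau> - 2 * z)"
    using cexp_add[of "\<tau> + 2 * z" 2] cexp_add[of "\<tau> - 2 * z" "-2"] by (auto simp: algebra_simps)
  thus ?thesis by (simp add: theta_def)
qed

context
  fixes \<tau> :: complex
  assumes tau: "Im \<tau> > 0"
begin

lemma norm_cexp_2_tau: "norm (cexp (2 * \<tau>)) < 1"
  by (rule norm_cexp_less_1) (simp add: tau)

lemma holomorphic_qprod_cexp [holomorphic_intros]:
  assumes "f holomorphic_on A"
  shows "(\<lambda>z. qprod (cexp (2 * \<tau>)) (f z)) holomorphic_on A"
  using holomorphic_on_compose_gen[OF assms holomorphic_qprod[OF norm_cexp_2_tau] subset_UNIV]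
  unfolding o_def .

lemma holomorphic_theta [holomorphic_intros]:
  "f holomorphic_on A \<Longrightarrow> (\<lambda>z. theta \<tau> (f z)) holomorphic_on A"
  unfolding theta_def
  by (intro holomorphic_on_mult holomorphic_qprod_cexp holomorphic_cexp holomorphic_on_add
        holomorphic_on_diff holomorphic_on_const)

text \<open>The translation removes the first factor of one product and adds a new first factor to
  the other; the ratio of these two factors is the exponential multiplier.\<close>

lemma theta_plus_tau: "theta \<tau> (z + \<tau>) = cexp (- \<tau> - 2 * z) * theta \<tau> z"
proof -
  let ?Q = "qprod (cexp (2 * \<tau>))"
  have "?Q (cexp (\<tau> + 2 * z)) = (1 + cexp (\<tau> + 2 * z)) * ?Q (cexp (\<tau> + 2 * (z + \<tau>)))"
    by (subst qprod_rec[OF norm_cexp_2_tau]) (simp add: algebra_simps flip: cexp_add)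
  moreover have "?Q (cexp (\<tau> - 2 * (z + \<tau>))) = (1 + cexp (\<tau> - 2 * (z + \<tau>))) * ?Q (cexp (\<tau> - 2 * z))"
    by (subst qprod_rec[OF norm_cexp_2_tau]) (simp add: algebra_simps flip: cexp_add)
  moreover have "1 + cexp (\<tau> - 2 * (z + \<tau>)) = cexp (- \<tau> - 2 * z) * (1 + cexp (\<tau> + 2 * z))"
    using cexp_add[of "- \<tau> - 2 * z" "\<tau> + 2 * z"] by (simp add: algebra_simps)
  ultimately show ?thesis
    by (simp add: theta_def)
qed

text \<open>A zero comes from a single vanishing factor, which fixes \<open>z\<close> modulo the
  periods. The term \<open>of_int m * 1\<close> is written so as to match
  \<open>add_int_multiple_iff\<close> with period 1.\<close>

lemma theta_eq_0_imp:
  assumes "theta \<tau> z = 0"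
  obtains m n :: int where "z = (1 + \<tau>) / 2 + of_int m * 1 + of_int n * \<tau>"
proof -
  \<comment> \<open>Taken at \<open>w = 2 * z\<close> and at \<open>w = - 2 * z\<close>, this treats
    the two products of theta alike.\<close>
  have aux: "\<exists>m k::int. w = 1 + 2 * of_int m - (2 * of_int k + 1) * \<tau>"
    if w: "qprod (cexp (2 * \<tau>)) (cexp (\<tau> + w)) = 0" for w
  proof -
    obtain n where "1 + cexp (2 * \<tau>) ^ n * cexp (\<tau> + w) = 0"
      using w qprod_eq_0_iff[OF norm_cexp_2_tau] by blast
    hence "cexp (of_nat n * (2 * \<tau>) + (\<tau> + w)) = cexp 1"
      by (simp add: cexp_power cexp_add add_eq_0_iff)
    then obtain m :: int where "of_nat n * (2 * \<tau>) + (\<tau> + w) = 1 + 2 * of_int m"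
      by (subst (asm) cexp_eq_iff) auto
    hence "w = 1 + 2 * of_int m - (2 * of_int (int n) + 1) * \<tau>"
      by (simp add: algebra_simps)
    thus ?thesis by blast
  qed
  consider "qprod (cexp (2 * \<tau>)) (cexp (\<tau> + 2 * z)) = 0"
    | "qprod (cexp (2 * \<tau>)) (cexp (\<tau> + (- 2 * z))) = 0"
    using assms by (auto simp: theta_def)
  thus ?thesis
  proof cases
    case 1
    obtain m k :: int where "2 * z = 1 + 2 * of_int m - (2 * of_int k + 1) * \<tau>"
      using aux[OF 1] by blast
    hence "z = (1 + 2 * of_int m - (2 * of_int k + 1) * \<tau>) / 2"
      by (simp add: eq_divide_eq mult.commute)
    also have "\<dots> = (1 + \<tau>) / 2 + of_int m * 1 + of_int (- k - 1) * \<tau>"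
      by (simp add: field_simps)
    finally show ?thesis using that by blast
  next
    case 2
    obtain m k :: int where z: "- 2 * z = 1 + 2 * of_int m - (2 * of_int k + 1) * \<tau>"
      using aux[OF 2] by blast
    have "z = - (1 + 2 * of_int m - (2 * of_int k + 1) * \<tau>) / 2"
      unfolding z[symmetric] by simp
    also have "\<dots> = (1 + \<tau>) / 2 + of_int (- m - 1) * 1 + of_int k * \<tau>"
      by (simp add: field_simps)
    finally show ?thesis using that by blast
  qed
qed

lemma theta_half_period_zero: "theta \<tau> ((1 + \<tau>) / 2) = 0"
proof -
  have "qprod (cexp (2 * \<tau>)) (cexp (\<tau> - 2 * ((1 + \<tau>) / 2))) = 0"
    by (subst qprod_rec[OF norm_cexp_2_tau]) (simp add: field_simps)
  thus ?thesis by (simp add: theta_def)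
qed

text \<open>Only the factor \<open>1 + cexp (\<tau> - 2 * z)\<close> vanishes at the half period,
  with derivative 2 pi i there, while the cofactor \<open>G\<close> takes the nonzero value
  \<open>qprod q (-q) ^ 2\<close> for q = \<open>cexp (2 * \<tau>)\<close>.\<close>

lemma deriv_theta_half_period: "deriv (theta \<tau>) ((1 + \<tau>) / 2) \<noteq> 0"
proof -
  let ?Q = "qprod (cexp (2 * \<tau>))" and ?w = "(1 + \<tau>) / 2"
  define G where "G z = ?Q (cexp (\<tau> + 2 * z)) * ?Q (cexp (2 * \<tau>) * cexp (\<tau> - 2 * z))" for z
  have th: "theta \<tau> = (\<lambda>z. (1 + cexp (\<tau> - 2 * z)) * G z)"
  proof
    fix z
    show "theta \<tau> z = (1 + cexp (\<tau> - 2 * z)) * G z"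
      unfolding theta_def G_def
      by (subst (2) qprod_rec[OF norm_cexp_2_tau]) (simp add: mult_ac)
  qed
  have "G holomorphic_on UNIV"
    unfolding G_def by (intro holomorphic_intros)
  hence G: "(G has_field_derivative deriv G ?w) (at ?w)"
    by (meson UNIV_I holomorphic_derivI open_UNIV)
  have E: "cexp (\<tau> - 2 * ?w) = - 1"
    by (simp add: field_simps)
  have "G ?w \<noteq> 0"
  proof -
    have F: "cexp (\<tau> + 2 * ?w) = - cexp (2 * \<tau>)"
      using cexp_add[of 1 "2 * \<tau>"] by (simp add: add_divide_distrib algebra_simps)
    thus ?thesis
      unfolding G_def E F using qprod_neg_base_nonzero[OF norm_cexp_2_tau] by simp
  qed
  have "((\<lambda>z. (1 + cexp (\<tau> - 2 * z)) * G z) has_field_derivative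
           (2 * of_real pi * \<i>) * G ?w + deriv G ?w * (1 + cexp (\<tau> - 2 * ?w))) (at ?w)"
    using E by (auto intro!: derivative_eq_intros G simp: cexp_def)
  hence "deriv (theta \<tau>) ?w = (2 * of_real pi * \<i>) * G ?w"
    unfolding th E by (intro DERIV_imp_deriv) simp
  with \<open>G ?w \<noteq> 0\<close> show ?thesis by simp
qed

lemma deriv_theta_nonzero:
  assumes "theta \<tau> z = 0"
  shows "deriv (theta \<tau>) z \<noteq> 0"
proof -
  define Q where "Q z \<longleftrightarrow> theta \<tau> z = 0 \<and> deriv (theta \<tau>) z \<noteq> 0" for z
  have D: "(theta \<tau> has_field_derivative deriv (theta \<tau>) z) (at z)" for z
    using holomorphic_theta[OF holomorphic_on_ident, of UNIV] by (meson UNIV_I holomorphic_derivI open_UNIV)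
  have Q1: "Q (z + 1) \<longleftrightarrow> Q z" for z
  proof -
    have "((\<lambda>z. theta \<tau> (z + 1)) has_field_derivative deriv (theta \<tau>) (z + 1)) (at z)"
      using D[of "z + 1"] by (simp add: DERIV_shift)
    hence "deriv (theta \<tau>) (z + 1) = deriv (theta \<tau>) z"
      using DERIV_unique[OF _ D] by (simp add: theta_plus_1)
    thus ?thesis by (simp add: Q_def theta_plus_1)
  qed
  have Q2: "Q (z + \<tau>) \<longleftrightarrow> Q z" for z
  proof (cases "theta \<tau> z = 0")
    case True
    have 1: "((\<lambda>z. theta \<tau> (z + \<tau>)) has_field_derivative deriv (theta \<tau>) (z + \<tau>)) (at z)"
      using D[of "z + \<tau>"] by (simp add: DERIV_shift)
    have "(\<lambda>z. cexp (- \<tau> - 2 * z)) holomorphic_on UNIV"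
      by (intro holomorphic_intros)
    then obtain d where "((\<lambda>z. cexp (- \<tau> - 2 * z)) has_field_derivative d) (at z)"
      by (meson UNIV_I holomorphic_derivI open_UNIV)
    \<comment> \<open>At a zero of theta the product rule loses the term with the derivative
      \<open>d\<close> of the multiplier, so simplicity of the zero is preserved.\<close>
    from DERIV_mult[OF this D]
    have "((\<lambda>z. cexp (- \<tau> - 2 * z) * theta \<tau> z) has_field_derivative
            cexp (- \<tau> - 2 * z) * deriv (theta \<tau>) z) (at z)"
      using True by (simp add: mult_ac)
    hence "deriv (theta \<tau>) (z + \<tau>) = cexp (- \<tau> - 2 * z) * deriv (theta \<tau>) z"
      using DERIV_unique[OF 1] by (simp add: theta_plus_tau)
    thus ?thesis by (simp add: Q_def theta_plus_tau)
  qed (simp add: Q_def theta_plus_tau)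
  obtain m n :: int where z: "z = (1 + \<tau>) / 2 + of_int m * 1 + of_int n * \<tau>"
    using theta_eq_0_imp[OF assms] .
  have "Q z"
    unfolding z
    by (subst add_int_multiple_iff[where Q = Q, OF Q2], subst add_int_multiple_iff[where Q = Q, OF Q1])
       (simp only: Q_def theta_half_period_zero deriv_theta_half_period not_False_eq_True simp_thms)
  thus ?thesis by (simp add: Q_def)
qed

section \<open>Uniqueness of even quasi-periodic entire functions\<close>

text \<open>Here \<open>k\<close> is the multiplier of \<open>f\<close> in excess of that of theta,
  and it becomes the multiplier of the quotient. As it never vanishes, the one prescribed zero
  spreads over the whole zero set of theta.\<close>

lemma quasi_periodic_theta_factor:
  assumes f: "f holomorphic_on UNIV" and k: "k holomorphic_on UNIV" "\<And>z. k z \<noteq> 0"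
    and per1: "\<And>z. f (z + 1) = f z"
    and per2: "\<And>z. f (z + \<tau>) = cexp (- \<tau> - 2 * z) * k z * f z"
    and zero: "f ((1 + \<tau>) / 2) = 0"
  obtains h where "h holomorphic_on UNIV" "\<And>z. f z = h z * theta \<tau> z"
    "\<And>z. h (z + 1) = h z" "\<And>z. h (z + \<tau>) = k z * h z"
proof -
  have th: "theta \<tau> holomorphic_on UNIV"
    using holomorphic_theta[OF holomorphic_on_ident] by simp
  have "f z = 0" if z0: "theta \<tau> z = 0" for z
  proof -
    obtain m n :: int where z: "z = (1 + \<tau>) / 2 + of_int m * 1 + of_int n * \<tau>"
      using theta_eq_0_imp[OF z0] .
    show "f z = 0"
      unfolding z
      by (subst add_int_multiple_iff[where Q = "\<lambda>z. f z = 0"],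
          (use k in \<open>simp add: per2\<close>; fail),
          subst add_int_multiple_iff[where Q = "\<lambda>z. f z = 0"])
         (simp_all add: per1 zero)
  qed
  then obtain h where h: "h holomorphic_on UNIV" "\<And>z. f z = h z * theta \<tau> z"
    using entire_quotient[OF f th] deriv_theta_nonzero by metis
  have shift: "(\<lambda>z. h (z + w)) holomorphic_on UNIV" for w
    using holomorphic_on_compose_gen[OF holomorphic_on_add[OF holomorphic_on_ident holomorphic_on_const] h(1)]
    by (simp add: o_def)
  have "h (z + 1) = h z" for z
  proof (rule mult_right_cancel_simple_zeros[OF shift h(1) deriv_theta_nonzero])
    show "h (z + 1) * theta \<tau> z = h z * theta \<tau> z" for z
      using per1[of z] by (simp add: h(2) theta_plus_1)
  qed
  moreover have "h (z + \<tau>) = k z * h z" for z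
  proof (rule mult_right_cancel_simple_zeros[OF shift _ deriv_theta_nonzero])
    show "h (z + \<tau>) * theta \<tau> z = k z * h z * theta \<tau> z" for z
      using per2[of z] by (simp add: h(2) theta_plus_tau)
  qed (intro holomorphic_intros k h)
  ultimately show ?thesis using that h by blast
qed

text \<open>The points (1 - tau)/2 and (1 + tau)/2 are exchanged both by translation by tau, with
  multiplier -1, and by reflection followed by translation by 1, so the value is its own
  negative.\<close>

lemma even_quasi_periodic_zero:
  assumes "\<And>z. f (z + 1) = f z" "\<And>z. f (z + \<tau>) = cexp (- \<tau> - 2 * z) * f z"
    and "\<And>z. f (-z) = f z"
  shows "f ((1 + \<tau>) / 2) = 0"
proof -
  have "f ((1 - \<tau>) / 2 + \<tau>) = - f ((1 - \<tau>) / 2)"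
    unfolding assms(2) by (simp add: field_simps)
  moreover have "(1 - \<tau>) / 2 + \<tau> = (1 + \<tau>) / 2" "- ((1 - \<tau>) / 2) + 1 = (1 + \<tau>) / 2"
    by (simp_all add: field_simps)
  moreover from this have "f ((1 - \<tau>) / 2) = f ((1 + \<tau>) / 2)"
    by (metis assms(1,3))
  ultimately show ?thesis by simp
qed

text \<open>Evenness forces the zero required for division by theta, and the quotient is doubly
  periodic.\<close>

lemma even_quasi_periodic_eq_theta:
  assumes f: "f holomorphic_on UNIV"
    and per1: "\<And>z. f (z + 1) = f z" and per2: "\<And>z. f (z + \<tau>) = cexp (- \<tau> - 2 * z) * f z"
    and even: "\<And>z. f (-z) = f z"
  shows "\<exists>c. \<forall>z. f z = c * theta \<tau> z"
proof -
  obtain h where h: "h holomorphic_on UNIV" "\<And>z. f z = h z * theta \<tau> z"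
    "\<And>z. h (z + 1) = h z" "\<And>z. h (z + \<tau>) = h z"
    using quasi_periodic_theta_factor[of f "\<lambda>_. 1"] f per1 per2
      even_quasi_periodic_zero[of f, OF per1 per2 even] by auto
  obtain c where "\<forall>z. h z = c"
    using doubly_periodic_entire_constant[OF h(1) tau h(3,4)] by blast
  thus ?thesis using h(2) by auto
qed

text \<open>One division by theta leaves an even function with the multiplier of theta, to which the
  previous lemma applies. At the half period the squared multiplier is 1, so evenness alone forces
  no zero and the zero is a hypothesis.\<close>

lemma even_quasi_periodic_eq_theta_square:
  assumes f: "f holomorphic_on UNIV"
    and per1: "\<And>z. f (z + 1) = f z"
    and per2: "\<And>z. f (z + \<tau>) = cexp (- \<tau> - 2 * z) ^ 2 * f z"
    and even: "\<And>z. f (-z) = f z"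
    and zero: "f ((1 + \<tau>) / 2) = 0"
  shows "\<exists>c. \<forall>z. f z = c * theta \<tau> z ^ 2"
proof -
  obtain h where h: "h holomorphic_on UNIV" "\<And>z. f z = h z * theta \<tau> z"
    "\<And>z. h (z + 1) = h z" "\<And>z. h (z + \<tau>) = cexp (- \<tau> - 2 * z) * h z"
    by (rule quasi_periodic_theta_factor[of f "\<lambda>z. cexp (- \<tau> - 2 * z)"])
       (use f per1 per2 zero in \<open>auto simp: power2_eq_square intro!: holomorphic_intros\<close>)
  have "h (-z) = h z" for z
  proof (rule mult_right_cancel_simple_zeros[OF _ h(1) deriv_theta_nonzero])
    show "(\<lambda>z. h (- z)) holomorphic_on UNIV"
      using holomorphic_on_compose_gen[OF holomorphic_on_minus[OF holomorphic_on_ident] h(1)]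
      by (simp add: o_def)
    show "h (- z) * theta \<tau> z = h z * theta \<tau> z" for z
      using even[of z] by (simp add: h(2) theta_minus)
  qed
  then obtain c where "\<forall>z. h z = c * theta \<tau> z"
    using even_quasi_periodic_eq_theta[OF h(1,3,4)] by blast
  thus ?thesis using h(2) by (intro exI[of _ c]) (simp add: power2_eq_square mult_ac)
qed

section \<open>Theta constants and Jacobi's quartic identity\<close>

text \<open>Up to a common factor, the values at 0 and 1/2 are Jacobi's theta_3 and theta_4, and the
  value at tau/2 times \<open>cexp (\<tau> / 4)\<close> is theta_2.\<close>

lemma theta_0: "theta \<tau> 0 = qprod (cexp (2 * \<tau>)) (cexp \<tau>) ^ 2"
  by (simp add: theta_def power2_eq_square)

lemma theta_half: "theta \<tau> (1 / 2) = qprod (cexp (2 * \<tau>)) (- cexp \<tau>) ^ 2"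
  using cexp_add[of \<tau> 1] cexp_add[of \<tau> "-1"] by (simp add: theta_def power2_eq_square)

text \<open>The leading factor of \<open>qprod q 1\<close> is 2; its fourth power is the 16 in
  lambda.\<close>

lemma theta_half_tau: "theta \<tau> (\<tau> / 2) = 2 * qprod (cexp (2 * \<tau>)) (cexp (2 * \<tau>)) ^ 2"
proof -
  have "qprod (cexp (2 * \<tau>)) 1 = 2 * qprod (cexp (2 * \<tau>)) (cexp (2 * \<tau>))"
    by (subst qprod_rec[OF norm_cexp_2_tau]) simp
  thus ?thesis by (simp add: theta_def power2_eq_square)
qed

text \<open>The zeros have imaginary part an odd multiple of Im tau / 2, so theta has none on the
  real axis.\<close>

lemma theta_eq_0_imp_Im:
  assumes "theta \<tau> z = 0"
  shows "Im z \<noteq> 0"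
proof
  assume "Im z = 0"
  obtain m n :: int where z: "z = (1 + \<tau>) / 2 + of_int m * 1 + of_int n * \<tau>"
    using theta_eq_0_imp[OF assms] .
  have "real_of_int (1 + 2 * n) * Im \<tau> = 2 * Im z"
    unfolding z by (simp add: algebra_simps)
  hence "real_of_int (1 + 2 * n) = 0"
    using tau \<open>Im z = 0\<close> by simp
  hence "1 + 2 * n = 0" by (simp only: of_int_eq_0_iff)
  thus False by presburger
qed

lemma theta_0_nonzero: "theta \<tau> 0 \<noteq> 0"
  using theta_eq_0_imp_Im[of 0] by auto

lemma theta_half_nonzero: "theta \<tau> (1 / 2) \<noteq> 0"
  using theta_eq_0_imp_Im[of "1 / 2"] by auto

text \<open>A combination \<open>f\<close> of two squares of translated thetas is shown to be a
  multiple of \<open>theta \<tau> z ^ 2\<close>. Its value at 1/2 determines the multiple, and its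
  value at 0 is then the identity.\<close>

lemma jacobi_quartic:
  "theta \<tau> (1 / 2) ^ 4 + cexp \<tau> * theta \<tau> (\<tau> / 2) ^ 4 = theta \<tau> 0 ^ 4"
proof -
  define A B where "A = theta \<tau> (1 / 2)" and "B = theta \<tau> (\<tau> / 2)"
  \<comment> \<open>The factor \<open>cexp (2 * z)\<close> makes the second summand even and gives
    it the multiplier of theta squared. The constants \<open>A ^ 2\<close> and
    \<open>cexp \<tau> * B ^ 2\<close> make the summands cancel at the half period.\<close>
  define f where "f z = A ^ 2 * theta \<tau> (z + 1 / 2) ^ 2
    + cexp \<tau> * B ^ 2 * cexp (2 * z) * theta \<tau> (z + \<tau> / 2) ^ 2" for z
  have minus_half: "theta \<tau> (- z + 1 / 2) = theta \<tau> (z + 1 / 2)" for z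
    using theta_plus_1[of \<tau> "- z - 1 / 2"] theta_minus[of \<tau> "z + 1 / 2"] by (simp add: algebra_simps)
  have minus_half_tau: "theta \<tau> (- z + \<tau> / 2) = cexp (2 * z) * theta \<tau> (z + \<tau> / 2)" for z
    using theta_plus_tau[of "- z - \<tau> / 2"] theta_minus[of \<tau> "z + \<tau> / 2"]
    by (simp add: algebra_simps)
  have "\<exists>c. \<forall>z. f z = c * theta \<tau> z ^ 2"
  proof (rule even_quasi_periodic_eq_theta_square)
    show "f holomorphic_on UNIV"
      unfolding f_def by (intro holomorphic_intros)
    show "f (z + 1) = f z" for z
    proof -
      have shift: "theta \<tau> (z + 1 + w) = theta \<tau> (z + w)" for w
        using theta_plus_1[of \<tau> "z + w"] by (simp add: algebra_simps)
      have "cexp (2 * (z + 1)) = cexp (2 * z)"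
        using cexp_add[of "2 * z" 2] by (simp add: algebra_simps)
      thus ?thesis by (simp only: f_def shift)
    qed
    show "f (z + \<tau>) = cexp (- \<tau> - 2 * z) ^ 2 * f z" for z
    proof -
      have 1: "theta \<tau> (z + \<tau> + 1 / 2) = - cexp (- \<tau> - 2 * z) * theta \<tau> (z + 1 / 2)"
      proof -
        have "- \<tau> - 2 * (z + 1 / 2) = (- \<tau> - 2 * z) + - 1" by (simp add: algebra_simps)
        hence "cexp (- \<tau> - 2 * (z + 1 / 2)) = - cexp (- \<tau> - 2 * z)"
          by (simp only: cexp_add cexp_minus_1) simp
        moreover have "z + \<tau> + 1 / 2 = (z + 1 / 2) + \<tau>" by simp
        ultimately show ?thesis by (simp only: theta_plus_tau)
      qed
      have 2: "theta \<tau> (z + \<tau> + \<tau> / 2) = cexp (- \<tau>) * cexp (- \<tau> - 2 * z) * theta \<tau> (z + \<tau> / 2)"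
        using theta_plus_tau[of "z + \<tau> / 2"] by (simp add: algebra_simps flip: cexp_add)
      have 3: "cexp (2 * (z + \<tau>)) * cexp (- \<tau>) ^ 2 = cexp (2 * z)"
        by (simp add: cexp_power algebra_simps flip: cexp_add)
      show ?thesis
        unfolding f_def 1 2 3[symmetric] by algebra
    qed
    show "f (- z) = f z" for z
    proof -
      have "cexp (2 * (- z)) * cexp (2 * z) ^ 2 = cexp (2 * z)"
        by (simp add: cexp_power algebra_simps flip: cexp_add)
      thus ?thesis
        unfolding f_def minus_half minus_half_tau by (simp add: power_mult_distrib mult_ac)
    qed
    show "f ((1 + \<tau>) / 2) = 0"
    proof -
      have 1: "theta \<tau> ((1 + \<tau>) / 2 + 1 / 2) = B"
        using theta_plus_1[of \<tau> "\<tau> / 2"] by (simp add: B_def field_simps)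
      have 2: "theta \<tau> ((1 + \<tau>) / 2 + \<tau> / 2) = - cexp (- \<tau>) * A"
      proof -
        have "(1 + \<tau>) / 2 + \<tau> / 2 = 1 / 2 + \<tau>" by (simp add: field_simps)
        moreover have "cexp (- \<tau> - 2 * (1 / 2)) = - cexp (- \<tau>)"
          using cexp_add[of "- \<tau>" "- 1"] by simp
        ultimately show ?thesis by (simp only: theta_plus_tau A_def)
      qed
      have 3: "cexp (2 * ((1 + \<tau>) / 2)) = - cexp \<tau>"
      proof -
        have "2 * ((1 + \<tau>) / 2) = 1 + \<tau>" by (simp add: field_simps)
        thus ?thesis by (simp only: cexp_add) simp
      qed
      have "cexp \<tau> * cexp (- \<tau>) = 1" by (simp flip: cexp_add)
      hence "cexp \<tau> * cexp \<tau> * cexp (- \<tau>) ^ 2 = 1"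
        by (metis mult.right_neutral mult.assoc mult.left_commute power2_eq_square)
      thus ?thesis
        unfolding f_def 1 2 3 by (simp add: power_mult_distrib algebra_simps)
    qed
  qed
  then obtain c where c: "\<And>z. f z = c * theta \<tau> z ^ 2"
    by blast
  \<comment> \<open>At 1/2 the second summand vanishes, its theta being evaluated at the half
    period.\<close>
  have "f (1 / 2) = A ^ 2 * theta \<tau> 0 ^ 2"
  proof -
    have "theta \<tau> (1 / 2 + 1 / 2) = theta \<tau> 0" "theta \<tau> (1 / 2 + \<tau> / 2) = 0"
      using theta_plus_1[of \<tau> 0] theta_half_period_zero by (simp_all add: field_simps)
    thus ?thesis by (simp add: f_def)
  qed
  hence "c = theta \<tau> 0 ^ 2"
    using c[of "1 / 2"] theta_half_nonzero by (simp add: A_def)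
  moreover have "f 0 = A ^ 4 + cexp \<tau> * B ^ 4"
    by (simp add: f_def A_def B_def flip: power_add)
  ultimately show ?thesis
    using c[of 0] by (simp add: A_def B_def flip: power_add)
qed

lemma elliptic_lambda_theta:
  "elliptic_lambda \<tau> = cexp \<tau> * (theta \<tau> (\<tau> / 2) / theta \<tau> 0) ^ 4"
proof -
  let ?q = "cexp (2 * \<tau>)"
  have 1: "qpow \<tau> (real (Suc n)) = ?q ^ n * ?q" for n
    unfolding cexp_power cexp_add[symmetric] qpow_def unfolding cexp_def
    by (rule arg_cong[of _ _ exp]) (simp add: algebra_simps)
  have 2: "qpow \<tau> (real (Suc n) - 1 / 2) = ?q ^ n * cexp \<tau>" for n
    unfolding cexp_power cexp_add[symmetric] qpow_def unfolding cexp_def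
    by (rule arg_cong[of _ _ exp]) (simp add: algebra_simps)
  have "(\<lambda>n. (1 + ?q ^ n * ?q) ^ 8 / (1 + ?q ^ n * cexp \<tau>) ^ 8) has_prod
          (qprod ?q ?q ^ 8 / qprod ?q (cexp \<tau>) ^ 8)"
    by (intro has_prod_divide has_prod_power has_prod_qprod norm_cexp_2_tau)
  hence "elliptic_lambda \<tau> = 16 * qpow \<tau> (1 / 2) * (qprod ?q ?q ^ 8 / qprod ?q (cexp \<tau>) ^ 8)"
    unfolding elliptic_lambda_def 1 2 by (simp only: has_prod_unique[symmetric])
  moreover have "qpow \<tau> (1 / 2) = cexp \<tau>"
    by (simp add: qpow_def cexp_def)
  ultimately show ?thesis
    by (simp add: theta_half_tau theta_0 power_divide power_mult_distrib flip: power_mult)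
qed

lemma one_minus_elliptic_lambda:
  "1 - elliptic_lambda \<tau> = (theta \<tau> (1 / 2) / theta \<tau> 0) ^ 4"
proof -
  have "theta \<tau> 0 ^ 4 \<noteq> 0" using theta_0_nonzero by simp
  hence "(theta \<tau> (1 / 2) / theta \<tau> 0) ^ 4 + elliptic_lambda \<tau> = 1"
    unfolding elliptic_lambda_theta by (simp add: power_divide field_simps jacobi_quartic)
  thus ?thesis by (simp add: algebra_simps)
qed

end

section \<open>The action of the modular group on lambda\<close>

lemma elliptic_lambda_neq_1: "Im \<tau> > 0 \<Longrightarrow> elliptic_lambda \<tau> \<noteq> 1"
  using one_minus_elliptic_lambda[of \<tau>] theta_half_nonzero[of \<tau>] theta_0_nonzero[of \<tau>]
  by (metis cancel_comm_monoid_add_class.diff_cancel divide_eq_0_iff power_not_zero)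

text \<open>Adding 1 to tau negates the nome and fixes its square, which amounts to translating the
  theta argument by 1/2 and thus exchanges theta_3 and theta_4.\<close>

lemma elliptic_lambda_plus_1:
  assumes "Im \<tau> > 0"
  shows "elliptic_lambda (\<tau> + 1) = elliptic_lambda \<tau> / (elliptic_lambda \<tau> - 1)"
proof -
  have shift: "theta (\<tau> + 1) z = theta \<tau> (z + 1 / 2)" for z
  proof -
    have "cexp (2 * (\<tau> + 1)) = cexp (2 * \<tau>)"
      using cexp_add[of "2 * \<tau>" 2] by (simp add: algebra_simps)
    moreover have "cexp (\<tau> + 1 - 2 * z) = cexp (\<tau> - 2 * (z + 1 / 2))"
      using cexp_add[of "\<tau> - 2 * z" 1] cexp_add[of "\<tau> - 2 * z" "-1"] by (simp add: algebra_simps)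
    ultimately show ?thesis
      by (simp add: theta_def algebra_simps)
  qed
  have "theta (\<tau> + 1) ((\<tau> + 1) / 2) = theta \<tau> (\<tau> / 2)"
  proof -
    have "(\<tau> + 1) / 2 + 1 / 2 = \<tau> / 2 + 1" by (simp add: field_simps)
    thus ?thesis by (simp only: shift theta_plus_1)
  qed
  moreover have "theta (\<tau> + 1) 0 = theta \<tau> (1 / 2)"
    by (simp add: shift)
  ultimately have "elliptic_lambda (\<tau> + 1) = - cexp \<tau> * (theta \<tau> (\<tau> / 2) / theta \<tau> (1 / 2)) ^ 4"
    using assms by (simp add: elliptic_lambda_theta cexp_add)
  also have "\<dots> = - elliptic_lambda \<tau> / (1 - elliptic_lambda \<tau>)"
    using theta_0_nonzero[OF assms]
    by (subst one_minus_elliptic_lambda[OF assms]) (simp add: elliptic_lambda_theta[OF assms] power_divide)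
  finally show ?thesis
    by (metis minus_diff_eq minus_divide_divide minus_minus)
qed

lemma Im_minus_inverse_pos:
  assumes "Im \<tau> > 0"
  shows "Im (- 1 / \<tau>) > 0"
proof -
  have "Im (- 1 / \<tau>) = Im \<tau> / (norm \<tau>)\<^sup>2"
    by (simp add: Im_divide cmod_power2)
  moreover have "norm \<tau> > 0" using assms by auto
  ultimately show ?thesis using assms by simp
qed

text \<open>This is Jacobi's imaginary transformation with the constant \<open>c\<close> left
  undetermined, since it cancels in the quotient. A Gaussian factor times
  \<open>theta \<sigma> (z / \<tau>)\<close> has the periodicity of \<open>theta \<tau>\<close>,
  with the two periods in exchanged roles.\<close>

lemma elliptic_lambda_minus_inverse:
  assumes "Im \<tau> > 0"
  shows "elliptic_lambda (- 1 / \<tau>) = 1 - elliptic_lambda \<tau>"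
proof -
  define \<sigma> where "\<sigma> = - 1 / \<tau>"
  have \<sigma>: "Im \<sigma> > 0"
    unfolding \<sigma>_def using assms by (rule Im_minus_inverse_pos)
  have [simp]: "\<tau> \<noteq> 0" using assms by auto
  define f where "f z = cexp (- (z ^ 2) / \<tau>) * theta \<sigma> (z / \<tau>)" for z
  have "\<exists>c. \<forall>z. f z = c * theta \<tau> z"
  proof (rule even_quasi_periodic_eq_theta[OF assms])
    show "f holomorphic_on UNIV"
      unfolding f_def by (intro holomorphic_intros holomorphic_theta \<sigma>) auto
    show "f (- z) = f z" for z
      by (simp add: f_def theta_minus)
    show "f (z + \<tau>) = cexp (- \<tau> - 2 * z) * f z" for z
    proof -
      have "theta \<sigma> ((z + \<tau>) / \<tau>) = theta \<sigma> (z / \<tau>)"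
        using theta_plus_1[of \<sigma> "z / \<tau>"] by (simp add: add_divide_distrib)
      moreover have "cexp (- ((z + \<tau>) ^ 2) / \<tau>) = cexp (- \<tau> - 2 * z) * cexp (- (z ^ 2) / \<tau>)"
        unfolding cexp_add[symmetric] by (rule arg_cong[of _ _ cexp]) (simp add: field_simps power2_eq_square)
      ultimately show ?thesis by (simp add: f_def)
    qed
    show "f (z + 1) = f z" for z
    proof -
      have "theta \<sigma> (z / \<tau>) = cexp (- \<sigma> - 2 * ((z + 1) / \<tau>)) * theta \<sigma> ((z + 1) / \<tau>)"
        using theta_plus_tau[OF \<sigma>, of "(z + 1) / \<tau>"] by (simp add: \<sigma>_def add_divide_distrib)
      moreover have "cexp (- (z ^ 2) / \<tau>) * cexp (- \<sigma> - 2 * ((z + 1) / \<tau>)) = cexp (- ((z + 1) ^ 2) / \<tau>)"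
        unfolding cexp_add[symmetric] \<sigma>_def
        by (rule arg_cong[of _ _ cexp]) (simp add: field_simps power2_eq_square)
      ultimately show ?thesis by (simp add: f_def)
    qed
  qed
  then obtain c where c: "\<And>z. f z = c * theta \<tau> z"
    by blast
  have c0: "theta \<sigma> 0 = c * theta \<tau> 0"
    using c[of 0] by (simp add: f_def)
  \<comment> \<open>This is \<open>z = 1 / 2\<close>. The fourth power of the Gaussian factor
    \<open>cexp (\<sigma> / 4)\<close> is the nome occurring in lambda at
    \<open>\<sigma>\<close>.\<close>
  have "cexp (\<sigma> / 4) * theta \<sigma> (\<sigma> / 2) = c * theta \<tau> (1 / 2)"
  proof -
    have "1 / 2 / \<tau> = - (\<sigma> / 2)"
      by (simp add: \<sigma>_def)
    hence "theta \<sigma> (1 / 2 / \<tau>) = theta \<sigma> (\<sigma> / 2)"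
      by (simp only: theta_minus)
    moreover have "- ((1 / 2) ^ 2) / \<tau> = \<sigma> / 4"
      by (simp add: \<sigma>_def power2_eq_square)
    ultimately show ?thesis
      using c[of "1 / 2"] by (simp only: f_def)
  qed
  hence c1: "cexp \<sigma> * theta \<sigma> (\<sigma> / 2) ^ 4 = c ^ 4 * theta \<tau> (1 / 2) ^ 4"
    by (metis (no_types, lifting) cexp_power mult.commute nonzero_eq_divide_eq of_nat_numeral
        power_mult_distrib zero_neq_numeral)
  have "c \<noteq> 0" using c0 theta_0_nonzero[OF \<sigma>] by auto
  have "elliptic_lambda \<sigma> = c ^ 4 * theta \<tau> (1 / 2) ^ 4 / (c * theta \<tau> 0) ^ 4"
    by (simp add: elliptic_lambda_theta[OF \<sigma>] power_divide c1 flip: c0)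
  also have "\<dots> = 1 - elliptic_lambda \<tau>"
    using \<open>c \<noteq> 0\<close> by (simp add: one_minus_elliptic_lambda[OF assms] power_mult_distrib power_divide)
  finally show ?thesis by (simp add: \<sigma>_def)
qed

section \<open>The lambda function on the line with real part one half\<close>

lemma cis_minus_2_arctan:
  "(1 - \<i> * of_real y) / (1 + \<i> * of_real y) = cis (- 2 * arctan y)"
proof -
  have nz: "cos (arctan y) \<noteq> 0" by simp
  have y: "y = sin (arctan y) / cos (arctan y)"
    using tan_arctan[of y] by (simp add: tan_def)
  have "1 - \<i> * of_real y = cis (- arctan y) / of_real (cos (arctan y))"
       "1 + \<i> * of_real y = cis (arctan y) / of_real (cos (arctan y))"
    using nz y by (simp_all add: complex_eq_iff)
  hence "(1 - \<i> * of_real y) / (1 + \<i> * of_real y) = cis (- arctan y) / cis (arctan y)"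
    using nz by simp
  thus ?thesis by (simp add: cis_divide)
qed

text \<open>The phase of 1 - lambda at nome i r, divided by -16; the summands are the arguments of
  the factors 1 + i (-1)^n r^(2n+1).\<close>

definition angle :: "real \<Rightarrow> real" where
  "angle r = (\<Sum>n. (- 1) ^ n * arctan (r ^ (2 * n + 1)))"

lemma angle_term_bound:
  fixes r :: real
  assumes "0 \<le> r"
  shows "norm ((- 1) ^ n * arctan (r ^ (2 * n + 1))) \<le> r * (r ^ 2) ^ n"
proof -
  have "norm ((- 1) ^ n * arctan (r ^ (2 * n + 1))) \<le> \<bar>r ^ (2 * n + 1)\<bar>"
    using abs_arctan_le[of "r ^ (2 * n + 1)"] by (simp add: abs_mult power_abs)
  also have "\<dots> = r * (r ^ 2) ^ n"
    using assms by (simp add: power_mult abs_mult)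
  finally show ?thesis .
qed

lemma summable_angle:
  fixes r :: real
  assumes "0 \<le> r" "r < 1"
  shows "summable (\<lambda>n. (- 1) ^ n * arctan (r ^ (2 * n + 1)))"
proof (rule summable_comparison_test'[where N = 0])
  have "r ^ 2 < 1" using power_strict_mono[of r 1 2] assms by simp
  thus "summable (\<lambda>n. r * (r ^ 2) ^ n)"
    by (intro summable_mult summable_geometric) auto
qed (rule angle_term_bound[OF assms(1)])

text \<open>The geometric majorant is sharp enough to confine the phase at d = 3 to the interval
  below pi.\<close>

lemma angle_le:
  assumes "0 \<le> r" "r < 1"
  shows "angle r \<le> r / (1 - r ^ 2)"
proof -
  have r: "r ^ 2 < 1" using power_strict_mono[of r 1 2] assms by simp
  have "angle r \<le> (\<Sum>n. r * (r ^ 2) ^ n)"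
    unfolding angle_def
  proof (rule suminf_le)
    show "(- 1) ^ n * arctan (r ^ (2 * n + 1)) \<le> r * (r ^ 2) ^ n" for n
      using angle_term_bound[OF assms(1), of n] by simp
    show "summable (\<lambda>n. r * (r ^ 2) ^ n)"
      using r by (intro summable_mult summable_geometric) auto
  qed (rule summable_angle[OF assms])
  also have "\<dots> = r / (1 - r ^ 2)"
    using r by (subst suminf_mult) (auto simp: suminf_geometric summable_geometric)
  finally show ?thesis .
qed

text \<open>Grouping consecutive terms makes the sum positive and increasing termwise.\<close>
lemma angle_pairs_sums:
  assumes "0 \<le> r" "r < 1"
  shows "(\<lambda>n. arctan (r ^ (4 * n + 1)) - arctan (r ^ (4 * n + 3))) sums angle r"
proof -
  have "(\<lambda>n. (- 1) ^ n * arctan (r ^ (2 * n + 1))) sums angle r"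
    unfolding angle_def using summable_angle[OF assms] by (rule summable_sums)
  moreover have "(- 1 :: real) ^ (n + n) = 1" for n
    by (simp flip: mult_2)
  ultimately show ?thesis
    using sums_group[of "\<lambda>n. (- 1) ^ n * arctan (r ^ (2 * n + 1))" "angle r" 2]
    by (simp add: numeral_eq_Suc algebra_simps sum.atLeast_Suc_lessThan)
qed

lemma angle_pos:
  assumes "0 < r" "r < 1"
  shows "0 < angle r"
proof -
  note s = angle_pairs_sums[of r]
  have "0 < arctan (r ^ (4 * n + 1)) - arctan (r ^ (4 * n + 3))" for n
    using power_strict_decreasing[of "4 * n + 1" "4 * n + 3" r] assms
    by (simp only: arctan_less_iff diff_gt_0_iff_gt)
  hence "0 < (\<Sum>n. arctan (r ^ (4 * n + 1)) - arctan (r ^ (4 * n + 3)))"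
    using s assms by (intro suminf_pos) (auto simp: sums_iff)
  thus ?thesis using s assms by (simp add: sums_iff)
qed

text \<open>The derivative is nonnegative because (m + 2) x^2 (1 + x^(2m)) is at most m (1 +
  x^(2m+4)), which holds for x up to 1/2.\<close>

lemma arctan_power_diff_mono:
  fixes r s :: real
  assumes "0 \<le> r" "r \<le> s" "s \<le> 1 / 2" "m \<ge> 1"
  shows "arctan (r ^ m) - arctan (r ^ (m + 2)) \<le> arctan (s ^ m) - arctan (s ^ (m + 2))"
proof (rule DERIV_nonneg_imp_nondecreasing[OF assms(2)])
  fix x assume x: "r \<le> x" "x \<le> s"
  hence x0: "0 \<le> x" "x \<le> 1 / 2" using assms by auto
  let ?D = "inverse (1 + (x ^ m) ^ 2) * (real m * x ^ (m - Suc 0))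
    - inverse (1 + (x ^ (m + 2)) ^ 2) * (real (m + 2) * x ^ (m + 2 - Suc 0))"
  have "((\<lambda>x. arctan (x ^ m) - arctan (x ^ (m + 2))) has_real_derivative ?D) (at x)"
    by (intro DERIV_diff DERIV_chain2[OF DERIV_arctan] DERIV_pow)
  moreover have "0 \<le> ?D"
  proof -
    have frac: "inverse b * p \<le> inverse a * q" if "p * a \<le> q * b" "a > 0" "b > 0"
      for a b p q :: real
      using that by (simp add: field_simps)
    have x2: "x ^ 2 \<le> 1 / 4" using power_mono[OF x0(2,1), of 2] by (simp add: power2_eq_square)
    have "(x ^ m) ^ 2 \<le> x ^ 2"
      using power_decreasing[of 2 "m * 2" x] x0 assms(4) by (simp flip: power_mult)
    hence xm: "1 + (x ^ m) ^ 2 \<le> 5 / 4" using x2 by linarith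
    \<comment> \<open>Here m + 2 is at most 3 m, and 3 * (1/4) * (5/4) = 15/16 stays below
      1.\<close>
    have "real (m + 2) * (x ^ 2 * (1 + (x ^ m) ^ 2)) \<le> (3 * real m) * (1 / 4 * (5 / 4))"
      by (intro mult_mono x2 xm) (use assms(4) in auto)
    also have "\<dots> \<le> real m * (1 + (x ^ (m + 2)) ^ 2)"
    proof -
      have "(3 * real m) * (1 / 4 * (5 / 4)) \<le> real m * 1" by simp
      also have "\<dots> \<le> real m * (1 + (x ^ (m + 2)) ^ 2)" by (intro mult_left_mono) auto
      finally show ?thesis .
    qed
    finally have "x ^ (m - 1) * (real (m + 2) * (x ^ 2 * (1 + (x ^ m) ^ 2)))
        \<le> x ^ (m - 1) * (real m * (1 + (x ^ (m + 2)) ^ 2))"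
      using x0 by (intro mult_left_mono) auto
    moreover have "x ^ (m + 1) = x ^ (m - 1) * x ^ 2"
      using assms(4) by (simp flip: power_add)
    ultimately have "real (m + 2) * x ^ (m + 1) * (1 + (x ^ m) ^ 2)
        \<le> real m * x ^ (m - 1) * (1 + (x ^ (m + 2)) ^ 2)"
      by (simp only: mult_ac)
    moreover have "1 + (x ^ m) ^ 2 > 0" "1 + (x ^ (m + 2)) ^ 2 > 0"
      by (auto intro: add_pos_nonneg)
    ultimately have "inverse (1 + (x ^ (m + 2)) ^ 2) * (real (m + 2) * x ^ (m + 1))
        \<le> inverse (1 + (x ^ m) ^ 2) * (real m * x ^ (m - 1))"
      by (rule frac)
    moreover have "m + 2 - Suc 0 = m + 1" "m - Suc 0 = m - 1" by auto
    ultimately show ?thesis by (simp only: diff_ge_0_iff_ge)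
  qed
  ultimately show "\<exists>y. ((\<lambda>x. arctan (x ^ m) - arctan (x ^ (m + 2))) has_real_derivative y) (at x) \<and> 0 \<le> y"
    by blast
qed

lemma angle_mono:
  assumes "0 \<le> r" "r \<le> s" "s \<le> 1 / 2"
  shows "angle r \<le> angle s"
proof (rule sums_le)
  show "(\<lambda>n. arctan (r ^ (4 * n + 1)) - arctan (r ^ (4 * n + 3))) sums angle r"
       "(\<lambda>n. arctan (s ^ (4 * n + 1)) - arctan (s ^ (4 * n + 3))) sums angle s"
    using assms by (intro angle_pairs_sums; simp)+
  show "arctan (r ^ (4 * n + 1)) - arctan (r ^ (4 * n + 3))
      \<le> arctan (s ^ (4 * n + 1)) - arctan (s ^ (4 * n + 3))" for n
    using arctan_power_diff_mono[OF assms, of "4 * n + 1"] by (simp add: numeral_eq_Suc)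
qed

text \<open>The nome is i r, so the nth factors of the two products are 1 - i y and 1 + i y with
  \<open>y n\<close> real, and their quotient is a phase of angle \<open>- 2 * arctan (y n)\<close>.
  The quotient of products enters to the eighth power, hence the 16.\<close>

lemma one_minus_elliptic_lambda_eq_cis:
  assumes "d > 0"
  shows "1 - elliptic_lambda ((1 + sqrt_neg d) / 2) = cis (- 16 * angle (exp (- pi * sqrt d / 2)))"
proof -
  define \<tau> where "\<tau> = (1 + sqrt_neg d) / 2"
  define r where "r = exp (- pi * sqrt d / 2)"
  have \<tau>: "Im \<tau> > 0" using assms by (simp add: \<tau>_def sqrt_neg_def)
  have r: "0 < r" "r < 1" using assms by (auto simp: r_def)
  have x: "cexp \<tau> = \<i> * of_real r"
  proof -
    have "cexp \<tau> = exp (\<i> * of_real (pi / 2) + of_real (- pi * sqrt d / 2))"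
      unfolding cexp_def \<tau>_def sqrt_neg_def
      by (rule arg_cong[of _ _ exp]) (simp add: field_simps complex_eq_iff)
    also have "\<dots> = \<i> * of_real r"
      unfolding exp_add exp_of_real cis_conv_exp[symmetric] r_def by simp
    finally show ?thesis .
  qed
  have q: "cexp (2 * \<tau>) = - (of_real r ^ 2)"
    using cexp_power[of \<tau> 2] by (simp add: x power_mult_distrib)
  define y where "y n = (- 1) ^ n * r ^ (2 * n + 1)" for n
  have qn: "cexp (2 * \<tau>) ^ n * cexp \<tau> = \<i> * of_real (y n)" for n
  proof -
    have "(- (of_real r ^ 2)) ^ n = (- 1) ^ n * (of_real r :: complex) ^ (2 * n)"
      by (metis (no_types) mult_minus1 power_mult power_mult_distrib)
    thus ?thesis unfolding q x y_def by (simp add: mult_ac)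
  qed
  have arctan_y: "arctan (y n) = (- 1) ^ n * arctan (r ^ (2 * n + 1))" for n
    by (cases "even n") (simp_all add: y_def arctan_minus)
  have "(\<lambda>n. (1 + cexp (2 * \<tau>) ^ n * - cexp \<tau>) / (1 + cexp (2 * \<tau>) ^ n * cexp \<tau>)) has_prod
          (qprod (cexp (2 * \<tau>)) (- cexp \<tau>) / qprod (cexp (2 * \<tau>)) (cexp \<tau>))"
    by (intro has_prod_divide has_prod_qprod norm_cexp_2_tau \<tau>)
  moreover have "(1 + cexp (2 * \<tau>) ^ n * - cexp \<tau>) / (1 + cexp (2 * \<tau>) ^ n * cexp \<tau>) =
      exp (\<i> * of_real (- 2 * arctan (y n)))" for n
    using cis_minus_2_arctan[of "y n"] qn[of n] by (simp add: cis_conv_exp)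
  ultimately have 1: "(\<lambda>n. exp (\<i> * of_real (- 2 * arctan (y n)))) has_prod
          (qprod (cexp (2 * \<tau>)) (- cexp \<tau>) / qprod (cexp (2 * \<tau>)) (cexp \<tau>))"
    by simp
  have sums: "(\<lambda>n. \<i> * of_real (- 2 * arctan (y n))) sums (\<i> * of_real (- 2 * angle r))"
    unfolding arctan_y angle_def using summable_angle[of r] r
    by (intro sums_mult sums_of_real) auto
  have "qprod (cexp (2 * \<tau>)) (- cexp \<tau>) / qprod (cexp (2 * \<tau>)) (cexp \<tau>) = cis (- 2 * angle r)"
    using has_prod_unique[OF 1] prodinf_exp[OF sums_summable[OF sums]] sums_unique[OF sums]
    by (simp add: cis_conv_exp)
  hence "(theta \<tau> (1 / 2) / theta \<tau> 0) ^ 4 = cis (- 2 * angle r) ^ 8"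
    unfolding theta_half[OF \<tau>] theta_0[OF \<tau>] power_divide[symmetric] by (simp flip: power_mult)
  thus ?thesis
    using one_minus_elliptic_lambda[OF \<tau>] by (simp add: Complex.DeMoivre \<tau>_def r_def)
qed

section \<open>The value at d = 3 and the bound on v\<close>

lemma exp_sqrt_3_bound: "exp (- pi * sqrt 3 / 2) < 1 / 7"
proof -
  have "sqrt 3 > 17 / 10"
    by (rule real_less_rsqrt) (simp add: power2_eq_square)
  hence "3 * (17 / 10) \<le> pi * sqrt 3"
    using pi_gt3 by (intro mult_mono) auto
  hence "5 / 2 \<le> pi * sqrt 3 / 2" by simp
  hence "exp (5 / 2) \<le> exp (pi * sqrt 3 / 2)" by simp
  \<comment> \<open>At 5/2 the quadratic Taylor bound gives only 6.625; at 5/4 it exceeds 3, and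
    squaring gives 9.\<close>
  moreover have "7 < exp (5 / 2 :: real)"
  proof -
    have "1 + 5 / 4 + (5 / 4)\<^sup>2 / 2 \<le> exp (5 / 4 :: real)"
      by (rule exp_lower_Taylor_quadratic) simp
    hence "3 < exp (5 / 4 :: real)" by (simp add: power2_eq_square)
    hence "3 * 3 < exp (5 / 4 :: real) * exp (5 / 4)" by (intro mult_strict_mono) auto
    thus ?thesis by (simp flip: exp_add)
  qed
  ultimately have "7 < exp (pi * sqrt 3 / 2)" by linarith
  thus ?thesis by (simp add: exp_minus field_simps)
qed

text \<open>The point \<open>\<rho>\<close> is fixed by tau -> -1/(tau - 1). Comparing the two
  transformation laws at \<open>\<rho> - 1\<close> makes \<open>\<mu>\<close> a primitive sixth root
  of unity, and a phase strictly between 0 and pi leaves only pi/3.\<close>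

lemma angle_at_3: "angle (exp (- pi * sqrt 3 / 2)) = pi / 48"
proof -
  define r where "r = exp (- pi * sqrt 3 / 2)"
  define \<rho> where "\<rho> = (1 + sqrt_neg 3) / 2"
  define \<mu> where "\<mu> = elliptic_lambda (\<rho> - 1)"
  have r: "0 < r" "r < 1 / 7" using exp_sqrt_3_bound by (auto simp: r_def)
  have im: "Im (\<rho> - 1) > 0" by (simp add: \<rho>_def sqrt_neg_def)
  have s: "sqrt_neg 3 ^ 2 = - 3"
    by (simp add: sqrt_neg_def power_mult_distrib flip: of_real_power)
  have "- 1 / (\<rho> - 1) = \<rho>"
  proof -
    have "\<rho> * (\<rho> - 1) = - 1"
      using s by (simp add: \<rho>_def field_simps power2_eq_square)
    moreover have "\<rho> - 1 \<noteq> 0" using im by auto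
    ultimately show ?thesis by (metis nonzero_eq_divide_eq)
  qed
  hence l: "elliptic_lambda \<rho> = 1 - \<mu>"
    using elliptic_lambda_minus_inverse[OF im] by (simp add: \<mu>_def)
  moreover have "elliptic_lambda \<rho> = \<mu> / (\<mu> - 1)"
    using elliptic_lambda_plus_1[OF im] by (simp add: \<mu>_def)
  moreover have "\<mu> \<noteq> 1" using elliptic_lambda_neq_1[OF im] by (simp add: \<mu>_def)
  ultimately have quad: "\<mu> ^ 2 - \<mu> + 1 = 0"
    by (simp add: field_simps power2_eq_square)
  define \<phi> where "\<phi> = 16 * angle r"
  have \<mu>: "\<mu> = cis (- \<phi>)"
    using one_minus_elliptic_lambda_eq_cis[of 3] l by (simp add: \<phi>_def \<rho>_def r_def)
  have "\<phi> > 0" using angle_pos[of r] r by (simp add: \<phi>_def)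
  have "\<phi> < pi"
  proof -
    have "r ^ 2 \<le> (1 / 7) ^ 2" using r by (intro power_mono) auto
    hence "r / (1 - r ^ 2) \<le> (1 / 7) / (1 - (1 / 7) ^ 2)"
      using r by (intro frac_le) (auto simp: power2_eq_square)
    hence "\<phi> \<le> 16 * ((1 / 7) / (1 - (1 / 7) ^ 2))"
      using angle_le[of r] r by (simp add: \<phi>_def)
    also have "\<dots> < 3" by (simp add: power2_eq_square)
    finally show ?thesis using pi_gt3 by linarith
  qed
  have "sin \<phi> > 0" using \<open>\<phi> > 0\<close> \<open>\<phi> < pi\<close> by (rule sin_gt_zero)
  moreover have "sin \<phi> * (1 - 2 * cos \<phi>) = 0"
    using arg_cong[OF quad, of Im] by (simp add: \<mu> power2_eq_square algebra_simps)
  ultimately have "cos \<phi> = cos (pi / 3)" by (simp add: cos_60)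
  hence "\<phi> = pi / 3"
    by (rule cos_inj_pi[rotated 4]) (use \<open>\<phi> > 0\<close> \<open>\<phi> < pi\<close> in auto)
  thus ?thesis by (simp add: \<phi>_def r_def)
qed

text \<open>With \<open>\<psi>\<close> half the phase, v is its cotangent. Monotonicity of
  \<open>angle\<close> and its value at d = 3 give \<open>\<psi> \<le> pi / 6\<close>, hence a
  cotangent of at least sqrt 3.\<close>

lemma elliptic_lambda_param:
  assumes "d \<ge> 3"
  shows "\<exists>v \<ge> sqrt 3. elliptic_lambda ((1 + sqrt_neg d) / 2) = 1 / (1 / 2 - \<i> * of_real (v / 2))"
proof -
  define r where "r = exp (- pi * sqrt d / 2)"
  define r0 where "r0 = exp (- pi * sqrt 3 / 2)"
  define \<psi> where "\<psi> = 8 * angle r"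
  have r0: "r0 < 1 / 7" using exp_sqrt_3_bound by (simp add: r0_def)
  have r: "0 < r" "r \<le> r0"
    using assms by (auto simp: r_def r0_def)
  have "\<psi> > 0" using angle_pos[of r] r r0 by (simp add: \<psi>_def)
  have "\<psi> \<le> pi / 6"
    using angle_mono[of r r0] r r0 angle_at_3 by (simp add: \<psi>_def r0_def)
  have sin_pos: "sin \<psi> > 0" using \<open>\<psi> > 0\<close> \<open>\<psi> \<le> pi / 6\<close> by (intro sin_gt_zero) auto
  have "sin \<psi> \<le> 1 / 2"
    using sin_monotone_2pi_le[of \<psi> "pi / 6"] \<open>\<psi> > 0\<close> \<open>\<psi> \<le> pi / 6\<close> by (simp add: sin_30)
  moreover have "cos \<psi> \<ge> sqrt 3 / 2"
    using cos_monotone_0_pi_le[of \<psi> "pi / 6"] \<open>\<psi> > 0\<close> \<open>\<psi> \<le> pi / 6\<close> by (simp add: cos_30)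
  moreover from calculation have "sqrt 3 * sin \<psi> \<le> sqrt 3 * (1 / 2)"
    by (intro mult_left_mono) auto
  ultimately have "sqrt 3 * sin \<psi> \<le> cos \<psi>"
    by linarith
  hence "sqrt 3 \<le> cos \<psi> / sin \<psi>"
    using sin_pos by (simp add: field_simps)
  moreover have "elliptic_lambda ((1 + sqrt_neg d) / 2) = 1 / (1 / 2 - \<i> * of_real (cos \<psi> / sin \<psi> / 2))"
  proof -
    \<comment> \<open>This writes lambda as 2 i sin psi cis (-psi), whose reciprocal has real part
      1/2 and imaginary part - cot psi / 2.\<close>
    have cis2: "cis (- (2 * \<psi>)) = 1 - 2 * \<i> * of_real (sin \<psi>) * cis (- \<psi>)"
      by (simp add: complex_eq_iff cos_double_sin sin_double power2_eq_square)
    have "elliptic_lambda ((1 + sqrt_neg d) / 2) = 1 - cis (- (2 * \<psi>))"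
      using one_minus_elliptic_lambda_eq_cis[of d] assms
      by (simp add: \<psi>_def r_def algebra_simps)
    also have "\<dots> = 2 * \<i> * of_real (sin \<psi>) * cis (- \<psi>)"
      by (simp add: cis2)
    also have "\<dots> * (1 / 2 - \<i> * of_real (cos \<psi> / sin \<psi> / 2)) = \<i> * cis (- \<psi>) * (- \<i> * cis \<psi>)"
    proof -
      have "2 * of_real (sin \<psi>) * (1 / 2 - \<i> * of_real (cos \<psi> / sin \<psi> / 2)) = - \<i> * cis \<psi>"
        using sin_pos by (simp add: complex_eq_iff)
      thus ?thesis by (simp add: mult_ac)
    qed
    also have "\<dots> = 1"
      by (simp add: mult_ac cis_mult)
    finally show ?thesis
      by (metis divide_eq_eq mult_zero_right zero_neq_one)
  qed
  ultimately show ?thesis by blast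
qed

section \<open>The radicals\<close>

text \<open>The formula for j is invariant under lambda -> 1/lambda, so it may be evaluated at
  \<open>w\<close>; there w (w - 1) and w^2 - w + 1 are real, as the real part of \<open>w\<close>
  is 1/2.\<close>

lemma elliptic_j_param:
  assumes l: "elliptic_lambda \<tau> = 1 / (1 / 2 - \<i> * of_real (v / 2))"
  shows "elliptic_j \<tau> = of_real (- 64 * (v ^ 2 - 3) ^ 3 / (v ^ 2 + 1) ^ 2)"
proof -
  define w where "w = 1 / 2 - \<i> * complex_of_real (v / 2)"
  have w: "w \<noteq> 0" "w - 1 \<noteq> 0" by (auto simp: w_def complex_eq_iff)
  have 1: "w * (w - 1) = - of_real ((v ^ 2 + 1) / 4)"
    by (simp add: w_def complex_eq_iff power2_eq_square field_simps)
  have 2: "w ^ 2 - w + 1 = - of_real ((v ^ 2 - 3) / 4)"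
    by (simp add: w_def complex_eq_iff power2_eq_square field_simps)
  have "1 - 1 / w + (1 / w) ^ 2 = (w ^ 2 - w + 1) / w ^ 2"
    using w by (simp add: field_simps power2_eq_square)
  moreover have "(1 / w) ^ 2 * (1 - 1 / w) ^ 2 = (w * (w - 1)) ^ 2 / w ^ 6"
  proof -
    have "1 - 1 / w = (w - 1) / w" using w by (simp add: field_simps)
    moreover have "w * (w - 1) / w ^ 3 = (1 / w) * ((w - 1) / w)"
      using w by (simp add: power3_eq_cube)
    moreover have "(w * (w - 1)) ^ 2 / w ^ 6 = (w * (w - 1) / w ^ 3) ^ 2"
      by (simp add: power_divide flip: power_mult)
    ultimately show ?thesis by (simp only: power_mult_distrib)
  qed
  ultimately have "elliptic_j \<tau> = 2 ^ 8 * ((w ^ 2 - w + 1) / w ^ 2) ^ 3 / ((w * (w - 1)) ^ 2 / w ^ 6)"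
    unfolding elliptic_j_def l w_def[symmetric] by simp
  also have "\<dots> = 2 ^ 8 * (w ^ 2 - w + 1) ^ 3 / (w * (w - 1)) ^ 2"
    using w by (simp add: power_divide flip: power_mult)
  also have "\<dots> = of_real (2 ^ 8 * (- ((v ^ 2 - 3) / 4)) ^ 3 / (- ((v ^ 2 + 1) / 4)) ^ 2)"
    unfolding 1 2 by (simp only: of_real_mult of_real_divide of_real_power of_real_minus of_real_numeral)
  also have "2 ^ 8 * (- ((v ^ 2 - 3) / 4)) ^ 3 / (- ((v ^ 2 + 1) / 4)) ^ 2 =
      - 64 * (v ^ 2 - 3) ^ 3 / (v ^ 2 + 1) ^ 2"
    by (simp add: power_divide)
  finally show ?thesis .
qed

lemma root_3_eqI: "x = y ^ 3 \<Longrightarrow> root 3 x = y"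
  using odd_real_root_power_cancel[of 3 y] by simp

lemma beta_rad_eq: "beta_rad d = (j_d d) ^ 2 * a_rad d"
  unfolding beta_rad_def a_rad_def by algebra

context
  fixes d v :: real
  assumes v: "v \<ge> sqrt 3" and j: "j_d d = - 64 * (v ^ 2 - 3) ^ 3 / (v ^ 2 + 1) ^ 2"
begin

lemma v_nonneg: "v \<ge> 0"
  using v real_sqrt_ge_zero[of 3] by linarith

lemma v_square_ge_3: "v ^ 2 - 3 \<ge> 0"
  using power_mono[OF v, of 2] by simp

lemma v_square_plus_1: "v ^ 2 + 1 > 0"
  by (intro add_nonneg_pos) auto

lemma j_d_nonpos: "j_d d \<le> 0"
proof -
  have "0 \<le> 64 * (v ^ 2 - 3) ^ 3 / (v ^ 2 + 1) ^ 2"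
    using v_square_ge_3 v_square_plus_1 by (intro divide_nonneg_nonneg mult_nonneg_nonneg) auto
  thus ?thesis by (simp add: j)
qed

text \<open>The classical fact that j - 1728 is a square up to sign: 1728 (v^2+1)^2 + 64 (v^2-3)^3 =
  64 v^2 (v^2+9)^2.\<close>

lemma a_rad_eq: "a_rad d = (8 * v * (v ^ 2 + 9) / (v ^ 2 + 1)) ^ 2"
  using v_square_plus_1 unfolding a_rad_def j
  by (simp add: power_divide divide_simps) algebra

lemma sqrt_a_rad: "sqrt (a_rad d) = 8 * v * (v ^ 2 + 9) / (v ^ 2 + 1)"
  unfolding a_rad_eq using v_nonneg v_square_plus_1
  by (intro real_sqrt_unique) (auto intro!: divide_nonneg_nonneg mult_nonneg_nonneg add_nonneg_nonneg)

lemma beta_d_eq: "beta_d d = 512 * v * (v ^ 2 - 3) ^ 3 * (v ^ 2 + 9) / (v ^ 2 + 1) ^ 3"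
proof -
  have *: "- (- 64 * p / u ^ 2) * (8 * v * w / u) = 512 * v * p * w / u ^ 3" for p u w :: real
    by (simp add: power3_eq_cube power2_eq_square)
  \<comment> \<open>The sign is that of \<open>\<bar>j_d d\<bar>\<close>, since \<open>j_d d\<close>
    is nonpositive.\<close>
  have "beta_d d = - j_d d * sqrt (a_rad d)"
    using j_d_nonpos by (simp add: beta_d_def beta_rad_eq real_sqrt_mult)
  also have "\<dots> = 512 * v * (v ^ 2 - 3) ^ 3 * (v ^ 2 + 9) / (v ^ 2 + 1) ^ 3"
    unfolding sqrt_a_rad j by (rule *)
  finally show ?thesis .
qed

lemma beta_roots:
  "root 3 (beta_d d - 24 * sqrt 3 * j_d d) = 8 * (v ^ 2 - 3) / (v ^ 2 + 1) * (v + sqrt 3)"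
  "root 3 (beta_d d + 24 * sqrt 3 * j_d d) = 8 * (v ^ 2 - 3) / (v ^ 2 + 1) * (v - sqrt 3)"
proof -
  \<comment> \<open>Leaving \<open>s\<close> as either square root of 3 yields both cube roots from
    one computation, by s = sqrt 3 and s = - sqrt 3.\<close>
  have *: "root 3 (beta_d d - 24 * s * j_d d) = 8 * (v ^ 2 - 3) / (v ^ 2 + 1) * (v + s)"
    if s: "s ^ 2 = 3" for s
  proof (rule root_3_eqI)
    \<comment> \<open>The cube is reduced modulo s^2 = 3, with the multiple of s^2 - 3 written
      out.\<close>
    have "(v + s) ^ 3 = v * (v ^ 2 + 9) + 3 * s * (v ^ 2 + 1) + (3 * v + s) * (s ^ 2 - 3)"
      by algebra
    hence "(v + s) ^ 3 = v * (v ^ 2 + 9) + 3 * s * (v ^ 2 + 1)"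
      using s by simp
    hence "(8 * (v ^ 2 - 3) / (v ^ 2 + 1) * (v + s)) ^ 3 =
        512 * (v ^ 2 - 3) ^ 3 / (v ^ 2 + 1) ^ 3 * (v * (v ^ 2 + 9) + 3 * s * (v ^ 2 + 1))"
      by (simp only: power_mult_distrib power_divide) simp
    also have "\<dots> = beta_d d - 24 * s * j_d d"
      unfolding beta_d_eq j using v_square_plus_1 by (simp add: divide_simps) algebra
    finally show "beta_d d - 24 * s * j_d d = (8 * (v ^ 2 - 3) / (v ^ 2 + 1) * (v + s)) ^ 3" ..
  qed
  show "root 3 (beta_d d - 24 * sqrt 3 * j_d d) = 8 * (v ^ 2 - 3) / (v ^ 2 + 1) * (v + sqrt 3)"
    by (rule *) simp
  show "root 3 (beta_d d + 24 * sqrt 3 * j_d d) = 8 * (v ^ 2 - 3) / (v ^ 2 + 1) * (v - sqrt 3)"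
    using *[of "- sqrt 3"] by simp
qed

text \<open>In the sum of the cube roots the sqrt 3 parts cancel, and all three radicals together
  collapse to 24 v.\<close>

lemma a_d_eq: "a_d d = v / 2"
  unfolding a_d_def sqrt_a_rad beta_roots using v_square_plus_1
  by (simp add: divide_simps) algebra

text \<open>In the difference of the cube roots the v parts cancel instead, so everything is
  rational in v.\<close>

lemma b_rad_eq: "b_rad d = (24 * v) ^ 2"
proof -
  have "sqrt 3 * (k * (v + sqrt 3) - k * (v - sqrt 3)) = 2 * k * (sqrt 3) ^ 2" for k
    by (simp add: algebra_simps power2_eq_square)
  from this[of "8 * (v ^ 2 - 3) / (v ^ 2 + 1)"]
  have "sqrt 3 * (8 * (v ^ 2 - 3) / (v ^ 2 + 1) * (v + sqrt 3) - 8 * (v ^ 2 - 3) / (v ^ 2 + 1) * (v - sqrt 3)) =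
      48 * (v ^ 2 - 3) / (v ^ 2 + 1)"
    by simp
  hence "b_rad d = (48 * (v ^ 2 - 3) / (v ^ 2 + 1) + 24) ^ 2 + 1152 - 9 * j_d d"
    unfolding b_rad_def beta_roots by (simp only:)
  also have "\<dots> = (24 * v) ^ 2"
    unfolding j using v_square_plus_1 by (simp add: divide_simps) algebra
  finally show ?thesis .
qed

lemma b_d_eq: "b_d d = v / 2"
  unfolding b_d_def b_rad_eq real_sqrt_abs using v_nonneg by simp

text \<open>Both radicands are cubes over the field generated by v and sqrt 3. Their cube roots are
  conjugate under sqrt 3 -> - sqrt 3, so the irrational part cancels in the sum.\<close>

lemma t_d_eq: "t_d d = - (v ^ 2 - 3) * (v ^ 4 + 6 * v ^ 2 - 3) / (6 * (v ^ 2 + 1) ^ 2)"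
proof -
  let ?R = "\<lambda>s. 64 * (v ^ 2 - 3) / (v ^ 2 + 1) ^ 2 * (v ^ 4 + 6 * v ^ 2 - 3 - 8 * s * v)"
  have *: "root 3 (- 884736 * j_d d + 2304 * j_d d ^ 2 - j_d d ^ 3 - 12288 * s * beta_d d) = ?R s"
    if s: "s ^ 2 = 3" for s
  proof (rule root_3_eqI)
    define u where "u = v ^ 2 + 1"
    define p where "p = v ^ 2 - 3"
    have "(a - b * s) ^ 3 = a ^ 3 - 3 * a ^ 2 * b * s + 9 * a * b ^ 2 - 3 * b ^ 3 * s
        + (3 * a * b ^ 2 - b ^ 3 * s) * (s ^ 2 - 3)" for a b :: real
      by algebra
    hence *: "(a - b * s) ^ 3 = a ^ 3 - 3 * a ^ 2 * b * s + 9 * a * b ^ 2 - 3 * b ^ 3 * s" for a b :: real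
      using s by simp
    have cube: "(v ^ 4 + 6 * v ^ 2 - 3 - 8 * s * v) ^ 3 =
        216 * u ^ 4 + 36 * p ^ 3 * u ^ 2 + p ^ 6 - 24 * s * v * (v ^ 2 + 9) * u ^ 3"
      using *[of "v ^ 4 + 6 * v ^ 2 - 3" "8 * v"] unfolding u_def p_def by algebra
    have "u \<noteq> 0" using v_square_plus_1 by (simp add: u_def)
    have "- 884736 * j_d d + 2304 * j_d d ^ 2 - j_d d ^ 3 - 12288 * s * beta_d d =
        64 ^ 3 * p ^ 3 / u ^ 6 * (216 * u ^ 4 + 36 * p ^ 3 * u ^ 2 + p ^ 6 - 24 * s * v * (v ^ 2 + 9) * u ^ 3)"
      unfolding beta_d_eq j u_def[symmetric] p_def[symmetric] using \<open>u \<noteq> 0\<close>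
      by (simp add: divide_simps) algebra
    also have "\<dots> = (?R s) ^ 3"
      unfolding cube[symmetric] u_def[symmetric] p_def[symmetric]
      by (simp add: power_mult_distrib power_divide flip: power_mult)
    finally show "- 884736 * j_d d + 2304 * j_d d ^ 2 - j_d d ^ 3 - 12288 * s * beta_d d = (?R s) ^ 3" .
  qed
  have "root 3 (- 884736 * j_d d + 2304 * j_d d ^ 2 - j_d d ^ 3 + 12288 * sqrt 3 * beta_d d) = ?R (- sqrt 3)"
    using *[of "- sqrt 3"] by simp
  hence "t_d d = - (1 / 768) * (?R (sqrt 3) + ?R (- sqrt 3))"
    unfolding t_d_def using *[of "sqrt 3"] by (simp only: real_sqrt_pow2 zero_le_numeral)
  also have "\<dots> = - (v ^ 2 - 3) * (v ^ 4 + 6 * v ^ 2 - 3) / (6 * (v ^ 2 + 1) ^ 2)"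
    using v_square_plus_1 by (simp add: divide_simps) algebra
  finally show ?thesis .
qed

lemma c_rad_eq: "c_rad d = (24 * v) ^ 2"
  unfolding c_rad_def t_d_eq j using v_square_plus_1
  by (simp add: divide_simps) algebra

lemma c_d_eq: "c_d d = v / 2"
  unfolding c_d_def c_rad_eq real_sqrt_abs using v_nonneg by simp

end

section \<open>The six values of lambda\<close>

theorem theorem1p1:
  fixes d :: real
  assumes "d \<ge> 3"
  shows
    "radicals_real d \<and>
     (let s = sqrt_neg d;
          a = complex_of_real (a_d d);
          b = complex_of_real (b_d d);
          c = complex_of_real (c_d d)
      in
        (elliptic_lambda ((1 + s) / 2) = 1 / (1/2 - \<i> * a) \<and>
         elliptic_lambda ((1 + s) / 2) = 1 / (1/2 - \<i> * b) \<and>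
         elliptic_lambda ((1 + s) / 2) = 1 / (1/2 - \<i> * c)) \<and>
        (elliptic_lambda ((s - 1) / (s + 1)) = 1/2 + \<i> * a \<and>
         elliptic_lambda ((s - 1) / (s + 1)) = 1/2 + \<i> * b \<and>
         elliptic_lambda ((s - 1) / (s + 1)) = 1/2 + \<i> * c) \<and>
        (elliptic_lambda (2 / (1 - s)) = (\<i> * a - 1/2) / (\<i> * a + 1/2) \<and>
         elliptic_lambda (2 / (1 - s)) = (\<i> * b - 1/2) / (\<i> * b + 1/2) \<and>
         elliptic_lambda (2 / (1 - s)) = (\<i> * c - 1/2) / (\<i> * c + 1/2)) \<and>
        (elliptic_lambda (- (2 / (1 + s))) = (\<i> * a + 1/2) / (\<i> * a - 1/2) \<and>
         elliptic_lambda (- (2 / (1 + s))) = (\<i> * b + 1/2) / (\<i> * b - 1/2) \<and>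
         elliptic_lambda (- (2 / (1 + s))) = (\<i> * c + 1/2) / (\<i> * c - 1/2)) \<and>
        (elliptic_lambda (- ((s + 1) / (s - 1))) = 1/2 - \<i> * a \<and>
         elliptic_lambda (- ((s + 1) / (s - 1))) = 1/2 - \<i> * b \<and>
         elliptic_lambda (- ((s + 1) / (s - 1))) = 1/2 - \<i> * c) \<and>
        (elliptic_lambda ((- 1 + s) / 2) = 1 / (1/2 + \<i> * a) \<and>
         elliptic_lambda ((- 1 + s) / 2) = 1 / (1/2 + \<i> * b) \<and>
         elliptic_lambda ((- 1 + s) / 2) = 1 / (1/2 + \<i> * c)))"
proof -
  define s where "s = sqrt_neg d"
  obtain v where v: "v \<ge> sqrt 3"
    and l: "elliptic_lambda ((1 + s) / 2) = 1 / (1 / 2 - \<i> * of_real (v / 2))"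
    using elliptic_lambda_param[OF assms] by (auto simp: s_def)
  have j: "elliptic_j ((1 + sqrt_neg d) / 2) = of_real (- 64 * (v ^ 2 - 3) ^ 3 / (v ^ 2 + 1) ^ 2)"
    using elliptic_j_param[OF l] by (simp only: s_def)
  \<comment> \<open>The value of j is real, so passing to the real part in \<open>j_d\<close> loses
    nothing.\<close>
  hence jd: "j_d d = - 64 * (v ^ 2 - 3) ^ 3 / (v ^ 2 + 1) ^ 2"
    unfolding j_d_def by (simp only: Re_complex_of_real)
  have "elliptic_j ((1 + sqrt_neg d) / 2) \<in> \<real>"
    unfolding j by (rule Reals_of_real)
  hence real: "radicals_real d"
    using j_d_nonpos[OF v jd]
    by (simp add: radicals_real_def beta_rad_eq a_rad_eq[OF v jd] b_rad_eq[OF v jd] c_rad_eq[OF v jd])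

  define x where "x = \<i> * complex_of_real (v / 2)"
  have abc: "\<i> * complex_of_real (a_d d) = x" "\<i> * complex_of_real (b_d d) = x"
      "\<i> * complex_of_real (c_d d) = x"
    by (simp_all only: x_def a_d_eq[OF v jd] b_d_eq[OF v jd] c_d_eq[OF v jd])
  have x: "1 / 2 + x \<noteq> 0" "1 / 2 - x \<noteq> 0" "x - 1 / 2 \<noteq> 0" "x + 1 / 2 \<noteq> 0"
    by (auto simp: x_def complex_eq_iff)
  have Im_s: "Im s > 0" using assms by (simp add: s_def sqrt_neg_def)
  hence s: "1 + s \<noteq> 0" "1 - s \<noteq> 0" "s + 1 \<noteq> 0" "s - 1 \<noteq> 0"
    by (auto simp: complex_eq_iff)
  \<comment> \<open>Clears the common denominator when a fraction is inserted into lambda/(lambda -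
    1).\<close>
  have quot: "a / b / (a / b - 1) = a / (a - b)" if "b \<noteq> 0" for a b :: complex
  proof -
    have "a / b - 1 = (a - b) / b" using that by (simp add: diff_divide_distrib)
    thus ?thesis using that by simp
  qed
  define \<tau> where "\<tau> = (1 + s) / 2"
  have im: "Im \<tau> > 0" "Im (\<tau> - 1) > 0" using Im_s by (simp_all add: \<tau>_def)
  have l1: "elliptic_lambda \<tau> = 1 / (1 / 2 - x)"
    using l by (simp add: x_def \<tau>_def)
  \<comment> \<open>The map a -> a/(a - 1) is an involution, so the law for tau + 1 also gives the
    value at \<open>z\<close> from that at \<open>z + 1\<close>.\<close>
  have shift: "elliptic_lambda z = elliptic_lambda (z + 1) / (elliptic_lambda (z + 1) - 1)"
    if z: "Im z > 0" for z
  proof -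
    have "a = b / (b - 1)" if "b = a / (a - 1)" "a \<noteq> 1" "b \<noteq> 1" for a b :: complex
      using that by (simp add: divide_simps) (simp add: algebra_simps)
    thus ?thesis
      using elliptic_lambda_plus_1[OF z] elliptic_lambda_neq_1[OF z] elliptic_lambda_neq_1[of "z + 1"] z
      by simp
  qed

  have l\<tau>: "elliptic_lambda (\<tau> - 1) = 1 / (1 / 2 + x)"
    using shift[OF im(2)] x by (simp add: l1 divide_simps) (simp add: algebra_simps)?
  moreover have "\<tau> - 1 = (- 1 + s) / 2" by (simp add: \<tau>_def field_simps)
  ultimately have l6: "elliptic_lambda ((- 1 + s) / 2) = 1 / (1 / 2 + x)" by (simp only:)

  have "elliptic_lambda (- 1 / \<tau>) = (x + 1 / 2) / (x - 1 / 2)"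
    unfolding elliptic_lambda_minus_inverse[OF im(1)] l1 using x
    by (simp add: divide_simps) (simp add: algebra_simps)?
  moreover have "- 1 / \<tau> = - (2 / (1 + s))" by (simp add: \<tau>_def)
  ultimately have l4: "elliptic_lambda (- (2 / (1 + s))) = (x + 1 / 2) / (x - 1 / 2)" by simp

  have "elliptic_lambda (- 1 / (\<tau> - 1)) = (x - 1 / 2) / (x + 1 / 2)"
  proof -
    have "1 - 1 / p = (p - 1) / p" if "p \<noteq> 0" for p :: complex
      using that by (simp add: diff_divide_distrib)
    from this[OF x(4)] have "1 - 1 / (1 / 2 + x) = (x - 1 / 2) / (x + 1 / 2)"
      by (simp add: add.commute)
    thus ?thesis
      unfolding elliptic_lambda_minus_inverse[OF im(2)] l\<tau> .
  qed
  moreover have "- 1 / (\<tau> - 1) = 2 / (1 - s)"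
    using s by (simp add: \<tau>_def divide_simps) (simp add: algebra_simps)?
  ultimately have l3: "elliptic_lambda (2 / (1 - s)) = (x - 1 / 2) / (x + 1 / 2)" by simp

  have "Im (- (2 / (1 + s))) > 0"
    using Im_minus_inverse_pos[OF im(1)] \<open>- 1 / \<tau> = - (2 / (1 + s))\<close> by simp
  from elliptic_lambda_plus_1[OF this]
  \<comment> \<open>The two remaining arguments are unit translates of those reached by inversion:
    this one by +1, and the last one, through \<open>shift\<close>, by -1.\<close>
  have "elliptic_lambda (- (2 / (1 + s)) + 1) = 1 / 2 + x"
    unfolding l4 quot[OF x(3)] by simp
  moreover have "- (2 / (1 + s)) + 1 = (s - 1) / (s + 1)"
    using s by (simp add: divide_simps) (simp add: algebra_simps)?
  ultimately have l2: "elliptic_lambda ((s - 1) / (s + 1)) = 1 / 2 + x" by simp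

  have shift_eq: "- ((s + 1) / (s - 1)) + 1 = 2 / (1 - s)"
    using s by (simp add: divide_simps) (simp add: algebra_simps)?
  have "Im (2 / (1 - s)) > 0"
    using Im_minus_inverse_pos[OF im(2)] \<open>- 1 / (\<tau> - 1) = 2 / (1 - s)\<close> by (simp only:)
  hence "Im (- ((s + 1) / (s - 1))) > 0"
    unfolding shift_eq[symmetric] by simp
  from shift[OF this] have l5: "elliptic_lambda (- ((s + 1) / (s - 1))) = 1 / 2 - x"
    unfolding shift_eq l3 quot[OF x(4)] by simp

  show ?thesis
    using real l1 l2 l3 l4 l5 l6
    unfolding Let_def s_def[symmetric] abc \<tau>_def by (simp only: simp_thms)
qed

end
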